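(* Let $f(x)=\max(0,1-|x|)$ for $x\in\mathbb{R}$. For each sufficiently large $\Delta>0$ there are functions $f^-=f^-_\Delta$ and $f^+=f^+_\Delta$ from $\mathbb{R}$ to $\mathbb{R}$ such that (1) the Fourier transforms $\hat f^{\pm}$ are supported in $[-\Delta,\Delta]$; (2) $f^-(x)\le f(x)\le f^+(x)$ for all $x\in\mathbb{R}$; and, as $\Delta\to\infty$, $$\int_{\mathbb{R}}|x|\bigl(f(x)-f^-(x)\bigr)\,dx=\frac{1+o(1)}{6\Delta^2}\quad\text{and}\quad\int_{\mathbb{R}}|x|\bigl(f^+(x)-f(x)\bigr)\,dx=\frac{1+o(1)}{12\Delta^2}.$$
   Context: The Fourier transform is $\hat g(t)=\int_{\mathbb{R}}g(x)e^{-2\pi i x t}\,dx$. *)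

theory Defs
  imports "HOL-Analysis.Analysis" "HOL-Library.Landau_Symbols"
begin

text \<open>
  Meaningful only for Lebesgue-integrable \<open>g\<close>: the Bochner integral of a
  non-integrable function is 0 by convention.
\<close>
definition fourier_transform :: "(real \<Rightarrow> complex) \<Rightarrow> real \<Rightarrow> complex" where
  "fourier_transform g t =
     (LINT x|lborel. g x * exp (- (2 * of_real pi * \<i> * of_real x * of_real t)))"

definition support :: "(real \<Rightarrow> complex) \<Rightarrow> real set" where
  "support h = closure {t. h t \<noteq> 0}"

definition tent :: "real \<Rightarrow> real" where
  "tent x = max 0 (1 - \<bar>x\<bar>)"

text \<open>
  Integrability is part of the notion, so that the Fourier transform is a
  genuine integral.
\<close>
definition band_limited :: "real \<Rightarrow> (real \<Rightarrow> real) \<Rightarrow> bool" where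
  "band_limited \<Delta> g \<longleftrightarrow>
     integrable lborel g \<and>
     support (fourier_transform (\<lambda>x. complex_of_real (g x))) \<subseteq> {-\<Delta>..\<Delta>}"

end

theory Submission
  imports Defs "HOL-Complex_Analysis.Cauchy_Integral_Formula" "HOL-Probability.Sinc_Integral"
    "HOL-Real_Asymp.Real_Asymp"
begin

text \<open>
  The kinks of the tent are repaired one at a time. Starting from
  \<open>\<bar>x\<bar> = (2/\<pi>) \<integral>\<^sub>0\<^sup>\<infinity> (1 - l\<^sup>2/(x\<^sup>2 + l\<^sup>2)) dl\<close>, a one-sided band-limited approximation of
  \<open>\<bar>x\<bar>\<close> is obtained by superposing approximations of the Poisson kernels: if \<open>H\<close> is an even entire
  function of exponential type \<open>2\<pi>(1 + d)\<close>, then \<open>(1 - H(x)/H(\<i>l))/(x\<^sup>2 + l\<^sup>2)\<close> is again entire of that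
  type, and it lies below or above \<open>1/(x\<^sup>2 + l\<^sup>2)\<close> according to the sign of \<open>H(x)/H(\<i>l)\<close>.
  With \<open>H(z) = (1 + s cos 2\<pi>z)/2\<close>, that is \<open>cos\<^sup>2 \<pi>z\<close> for \<open>s = 1\<close> and \<open>sin\<^sup>2 \<pi>z\<close> for \<open>s = -1\<close>, this gives the
  optimal majorant and minorant of \<open>\<bar>x\<bar>\<close>, with errors \<open>1/12\<close> and \<open>1/6\<close>. These errors decay only like \<open>x\<^sup>-\<^sup>2\<close>,
  so their first moments diverge; the extra factor \<open>(sin (\<pi>dz)/(\<pi>dz))\<^sup>2\<close> in \<open>H\<close> makes these moments
  \<open>O(1/d)\<close> and is harmless as \<open>d \<rightarrow> 0\<close>. Rescaled to bandwidth \<open>\<Delta>\<close>, the kinks at \<open>\<plusminus>1\<close>, where the weight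
  is \<open>1\<close>, contribute the main term, while the kink at \<open>0\<close> and the variation of the weight contribute
  \<open>O(1/(d \<Delta>\<^sup>3))\<close>, which is negligible for \<open>d = \<Delta>\<^sup>-\<^sup>1\<^sup>/\<^sup>2\<close>.
\<close>

section \<open>The Poisson formula in the half-plane\<close>

lemma has_bochner_integral_Poisson_kernel:
  assumes "l > 0"
  shows "has_bochner_integral lborel (\<lambda>x::real. 1 / (x\<^sup>2 + l\<^sup>2)) (pi / l)"
proof -
  have *: "has_bochner_integral lborel (\<lambda>x::real. inverse (1 + x\<^sup>2)) pi"
    using integrable_inverse_1_plus_square LBINT_inverse_1_plus_square
    by (simp add: has_bochner_integral_iff set_integrable_def
        interval_lebesgue_integral_def set_lebesgue_integral_def)
  have "has_bochner_integral lborel (\<lambda>x. inverse (1 + (0 + (1/l) * x)\<^sup>2)) (pi /\<^sub>R \<bar>1/l\<bar>)"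
    using * assms lborel_has_bochner_integral_real_affine_iff[of "1/l" "\<lambda>x. inverse (1 + x\<^sup>2)" pi 0]
    by simp
  from has_bochner_integral_mult_right[OF this, of "1 / l\<^sup>2"]
  show ?thesis
    by (rule has_bochner_integral_cong[THEN iffD1, rotated 3])
       (use assms in \<open>auto simp: field_simps power2_eq_square\<close>)
qed

lemma integrable_bounded_times_Poisson_kernel:
  fixes f :: "real \<Rightarrow> complex"
  assumes "l > 0" and [measurable]: "f \<in> borel_measurable borel" and "\<And>x. norm (f x) \<le> C"
  shows "integrable lborel (\<lambda>x. f x / complex_of_real (x\<^sup>2 + l\<^sup>2))"
proof (rule Bochner_Integration.integrable_bound)
  show "integrable lborel (\<lambda>x::real. C * (1 / (x\<^sup>2 + l\<^sup>2)))"
    using has_bochner_integral_Poisson_kernel[OF assms(1)]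
    by (intro integrable_mult_right) (auto simp: has_bochner_integral_iff)
  show "AE x in lborel. norm (f x / complex_of_real (x\<^sup>2 + l\<^sup>2)) \<le> norm (C * (1 / (x\<^sup>2 + l\<^sup>2)))"
  proof (rule AE_I2)
    fix x :: real
    have "norm (f x / complex_of_real (x\<^sup>2 + l\<^sup>2)) = norm (f x) / (x\<^sup>2 + l\<^sup>2)"
      by (simp add: norm_divide del: of_real_add of_real_power)
    also have "\<dots> \<le> C / (x\<^sup>2 + l\<^sup>2)"
      by (intro divide_right_mono assms) auto
    also have "\<dots> \<le> norm (C * (1 / (x\<^sup>2 + l\<^sup>2)))"
      by (simp add: divide_right_mono)
    finally show "norm (f x / complex_of_real (x\<^sup>2 + l\<^sup>2)) \<le> norm (C * (1 / (x\<^sup>2 + l\<^sup>2)))" .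
  qed
qed measurable

text \<open>Subtracting the value at \<open>\<i> l\<close> removes the pole of the integrand in the half-plane, so that
  Cauchy's theorem suffices and no winding number has to be computed.\<close>

lemma Poisson_formula_half_plane:
  fixes F :: "complex \<Rightarrow> complex"
  assumes F: "F holomorphic_on UNIV" and l: "l > 0"
    and bd: "\<And>z. Im z \<ge> 0 \<Longrightarrow> norm (F z) \<le> C"
  shows "(LINT x|lborel. F (of_real x) / complex_of_real (x\<^sup>2 + l\<^sup>2)) = of_real (pi / l) * F (\<i> * of_real l)"
proof -
  define a where "a = \<i> * complex_of_real l"
  define D where "D = (\<lambda>z. if z = a then deriv F a else (F z - F a) / (z - a))"
  \<comment> \<open>The quotient \<open>D\<close> is holomorphic also at \<open>a\<close>, so the
    only pole of \<open>P\<close> is \<open>- a\<close>, which lies outside the half-plane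
    \<open>Im z > - l\<close>. Away from \<open>a\<close>, \<open>P\<close> is
    \<open>(F z - F a) / (z\<^sup>2 + l\<^sup>2)\<close>.\<close>
  define P where "P = (\<lambda>z. D z / (z + a))"
  have contF: "continuous_on A F" for A
    using F holomorphic_on_imp_continuous_on continuous_on_subset by blast
  have meas[measurable]: "(\<lambda>x::real. F (of_real x)) \<in> borel_measurable borel"
    by (intro borel_measurable_continuous_onI continuous_on_compose2[OF contF[of UNIV]] continuous_intros) auto
  have D: "D holomorphic_on UNIV"
    unfolding D_def by (rule pole_lemma_open[OF F]) auto
  have P: "P holomorphic_on {z. Im z > -l}"
    unfolding P_def
    by (intro holomorphic_intros holomorphic_on_subset[OF D])
       (auto simp: a_def complex_eq_iff)
  have Peq: "P z = (F z - F a) / (z\<^sup>2 + of_real (l\<^sup>2))" if "z \<noteq> a" for z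
    using that by (simp add: P_def D_def a_def power2_eq_square algebra_simps)
  \<comment> \<open>Decay of order R^-2 against an arc of length pi R: the semicircle contributes
    nothing in the limit.\<close>
  have Pbd: "norm (P z) \<le> 2 * C / (R\<^sup>2 - l\<^sup>2)" if "norm z = R" "Im z \<ge> 0" "R > l" for z R
  proof -
    have ne: "z \<noteq> a" using that l by (auto simp: a_def norm_mult)
    have "norm (F z - F a) \<le> 2 * C"
      using norm_triangle_ineq4[of "F z" "F a"] bd[of z] bd[of a] that l by (auto simp: a_def)
    moreover have "R\<^sup>2 - l\<^sup>2 \<le> norm (z\<^sup>2 + of_real (l\<^sup>2))"
      using norm_diff_ineq[of "z\<^sup>2" "of_real (l\<^sup>2)"] that
      by (simp add: norm_power norm_mult del: of_real_power)
    moreover have "R\<^sup>2 - l\<^sup>2 > 0"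
      using that l by (simp add: power_strict_mono)
    ultimately show ?thesis
      unfolding Peq[OF ne] norm_divide
      by (intro frac_le order_trans[OF norm_ge_zero]) auto
  qed
  have P_real: "P (of_real x) = (F (of_real x) - F a) / complex_of_real (x\<^sup>2 + l\<^sup>2)" for x
    using Peq[of "of_real x"] l by (auto simp: a_def complex_eq_iff)
  have Pint: "integrable lborel (\<lambda>x. P (of_real x))"
    unfolding P_real
  proof (rule integrable_bounded_times_Poisson_kernel[OF l, where C = "2 * C"])
    show "cmod (F (complex_of_real x) - F a) \<le> 2 * C" for x
      using norm_triangle_ineq4[of "F x" "F a"] bd[of "of_real x"] bd[of a] l by (auto simp: a_def)
  qed measurable
  have bound: "norm (LINT x|lborel. indicator {-R..R} x *\<^sub>R P (of_real x)) \<le> 2 * C / (R\<^sup>2 - l\<^sup>2) * R * pi"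
    if R: "R > l" for R
  proof -
    have arc: "path_image (part_circlepath 0 R 0 pi) \<subseteq> {z. Im z \<ge> 0 \<and> norm z = R}"
      using R l by (auto simp: path_image_part_circlepath norm_mult sin_ge_zero Im_exp)
    have seg: "path_image (linepath (of_real (-R)) (of_real R)) \<subseteq> {z. Im z = 0}"
      by (auto simp: linepath_def path_image_def)
    let ?g = "linepath (of_real (-R)) (of_real R) +++ part_circlepath 0 R 0 pi"
    have cvx: "convex {z. Im z > -l}"
      by (rule convex_halfspace_Im_gt)
    have "(P has_contour_integral 0) ?g"
    proof (rule Cauchy_theorem_convex_simple[OF P cvx])
      show "path_image ?g \<subseteq> {z. Im z > - l}"
        using arc seg l by (subst path_image_join) (auto simp: subset_iff)
    qed (auto simp: exp_Euler)
    moreover have Parc: "P contour_integrable_on part_circlepath 0 R 0 pi"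
      using arc l by (intro contour_integrable_continuous_part_circlepath
          holomorphic_on_imp_continuous_on holomorphic_on_subset[OF P]) force
    moreover have Pseg: "P contour_integrable_on linepath (of_real (-R)) (of_real R)"
      using seg l by (intro contour_integrable_continuous_linepath
          holomorphic_on_imp_continuous_on holomorphic_on_subset[OF P])
        (auto simp: path_image_linepath)
    ultimately have "contour_integral (linepath (of_real (-R)) (of_real R)) P
        + contour_integral (part_circlepath 0 R 0 pi) P = 0"
      by (metis contour_integral_join contour_integral_unique valid_path_linepath
           valid_path_part_circlepath)
    moreover have "contour_integral (linepath (of_real (-R)) (of_real R)) P
        = integral {-R..R} (\<lambda>x. P (of_real x))"
      using R l by (subst contour_integral_linepath_Reals_eq) auto
    moreover have "integral {-R..R} (\<lambda>x. P (of_real x)) = (LINT x|lborel. indicator {-R..R} x *\<^sub>R P (of_real x))"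
      using set_borel_integral_eq_integral(2)[of "{-R..R}" "\<lambda>x. P (of_real x)"]
        integrable_mult_indicator[OF _ Pint, of "{-R..R}"]
      by (simp add: set_lebesgue_integral_def set_integrable_def)
    moreover have "norm (contour_integral (part_circlepath 0 R 0 pi) P) \<le> 2 * C / (R\<^sup>2 - l\<^sup>2) * R * \<bar>pi - 0\<bar>"
    proof (rule contour_integral_bound_part_circlepath[OF Parc])
      have "C \<ge> 0" using bd[of 0] norm_ge_zero order_trans by (metis le_numeral_extra(3) zero_complex.sel(2))
      then show "0 \<le> 2 * C / (R\<^sup>2 - l\<^sup>2)"
        using R l by (simp add: power_mono)
    qed (use R l arc Pbd in auto)
    ultimately show ?thesis
      by (simp add: add_eq_0_iff)
  qed
  have "((\<lambda>R. LINT x|lborel. indicator {-R..R} x *\<^sub>R P (of_real x)) \<longlongrightarrow> (LINT x|lborel. P (of_real x))) at_top"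
  proof (rule integral_dominated_convergence_at_top)
    show "integrable lborel (\<lambda>x. norm (P (of_real x)))" using Pint by simp
    show "(\<lambda>x. P (of_real x)) \<in> borel_measurable lborel" using Pint by auto
    then show "(\<lambda>x. indicator {-R..R} x *\<^sub>R P (of_real x)) \<in> borel_measurable lborel" for R :: real
      by measurable
    show "AE x in lborel. ((\<lambda>R. indicator {-R..R} x *\<^sub>R P (of_real x)) \<longlongrightarrow> P (of_real x)) at_top"
    proof (rule AE_I2)
      fix x :: real
      have "\<forall>\<^sub>F R in at_top. indicator {-R..R} x *\<^sub>R P (of_real x) = P (of_real x)"
        using eventually_ge_at_top[of "\<bar>x\<bar>"] by eventually_elim (auto simp: indicator_def)
      then show "((\<lambda>R. indicator {-R..R} x *\<^sub>R P (of_real x)) \<longlongrightarrow> P (of_real x)) at_top"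
        by (rule tendsto_eventually)
    qed
  qed (auto simp: indicator_def)
  moreover have "((\<lambda>R. LINT x|lborel. indicator {-R..R} x *\<^sub>R P (of_real x)) \<longlongrightarrow> 0) at_top"
  proof (rule Lim_null_comparison)
    show "\<forall>\<^sub>F R in at_top. norm (LINT x|lborel. indicator {-R..R} x *\<^sub>R P (of_real x)) \<le> 2 * C / (R\<^sup>2 - l\<^sup>2) * R * pi"
      using eventually_gt_at_top[of l] by eventually_elim (rule bound)
    show "((\<lambda>R. 2 * C / (R\<^sup>2 - l\<^sup>2) * R * pi) \<longlongrightarrow> 0) at_top"
      by real_asymp
  qed
  \<comment> \<open>Hence \<open>F\<close> may be replaced by the constant \<open>F a\<close> under
    the integral, and only the total mass pi/l of the Poisson kernel remains.\<close>
  ultimately have 0: "(LINT x|lborel. P (of_real x)) = 0"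
    by (rule tendsto_unique[rotated]) simp
  have Fint: "integrable lborel (\<lambda>x. F (of_real x) / complex_of_real (x\<^sup>2 + l\<^sup>2))"
    by (rule integrable_bounded_times_Poisson_kernel[OF l meas, where C = C]) (auto intro: bd)
  have "has_bochner_integral lborel (\<lambda>x. complex_of_real (1 / (x\<^sup>2 + l\<^sup>2))) (of_real (pi / l))"
    by (rule has_bochner_integral_of_real[OF has_bochner_integral_Poisson_kernel[OF l]])
  from has_bochner_integral_mult_right[OF this, of "F a"]
  have "has_bochner_integral lborel (\<lambda>x. F a / complex_of_real (x\<^sup>2 + l\<^sup>2)) (of_real (pi / l) * F a)"
    by (simp add: mult_ac)
  with Fint 0 show ?thesis
    by (simp add: P_real diff_divide_distrib has_bochner_integral_iff a_def Bochner_Integration.integral_diff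
        del: of_real_add of_real_power)
qed

section \<open>Even entire functions of exponential type\<close>

definition csinc :: "complex \<Rightarrow> complex" where
  "csinc z = (if z = 0 then 1 else sin z / z)"

text \<open>\<open>csinc\<close> is the difference quotient of sin at 0, completed by the derivative
  there, so the singularity is removable.\<close>

lemma csinc_holomorphic: "csinc holomorphic_on UNIV"
proof -
  have "csinc = (\<lambda>z. if z = 0 then deriv sin 0 else (sin z - sin 0) / (z - 0))"
    using DERIV_imp_deriv[OF DERIV_sin, of "0 :: complex"] by (auto simp: csinc_def fun_eq_iff)
  then show ?thesis
    using pole_lemma_open[of sin UNIV 0] by (simp add: holomorphic_on_def field_differentiable_within_sin)
qed

lemma continuous_on_csinc: "continuous_on A csinc"
  using holomorphic_on_imp_continuous_on[OF csinc_holomorphic] continuous_on_subset by blast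

lemma csinc_minus: "csinc (- z) = csinc z"
  by (simp add: csinc_def)

lemma norm_cos_le_exp: "norm (cos z) \<le> exp \<bar>Im z\<bar>"
proof -
  have "norm (exp (\<i> * z) + exp (- (\<i> * z))) \<le> norm (exp (\<i> * z)) + norm (exp (- (\<i> * z)))"
    by (rule norm_triangle_ineq)
  also have "\<dots> \<le> 2 * exp \<bar>Im z\<bar>"
    using add_mono[of "norm (exp (\<i> * z))" "exp \<bar>Im z\<bar>" "norm (exp (- (\<i> * z)))" "exp \<bar>Im z\<bar>"] by simp
  finally show ?thesis by (simp add: cos_exp_eq norm_divide)
qed

lemma norm_sin_le_exp: "norm (sin z) \<le> exp \<bar>Im z\<bar>"
proof -
  have "norm (exp (\<i> * z) - exp (- (\<i> * z))) \<le> norm (exp (\<i> * z)) + norm (exp (- (\<i> * z)))"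
    by (rule norm_triangle_ineq4)
  also have "\<dots> \<le> 2 * exp \<bar>Im z\<bar>"
    using add_mono[of "norm (exp (\<i> * z))" "exp \<bar>Im z\<bar>" "norm (exp (- (\<i> * z)))" "exp \<bar>Im z\<bar>"] by simp
  finally show ?thesis by (simp add: sin_exp_eq norm_divide norm_mult)
qed

text \<open>Compactness gives the bound on the unit disc; outside it the division by
  \<open>z\<close> only helps, and the bound for sin suffices.\<close>

lemma csinc_bound: obtains B where "B \<ge> 0" "\<And>z. norm (csinc z) \<le> B * exp \<bar>Im z\<bar>"
proof -
  have "bounded (csinc ` cball 0 1)"
    by (intro compact_imp_bounded compact_continuous_image continuous_on_csinc) auto
  then obtain B where B: "\<And>z. z \<in> cball 0 1 \<Longrightarrow> norm (csinc z) \<le> B"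
    unfolding bounded_iff by (metis imageI)
  have "norm (csinc z) \<le> max 1 B * exp \<bar>Im z\<bar>" for z
  proof (cases "norm z \<le> 1")
    case True
    then have "norm (csinc z) \<le> max 1 B * 1" using B[of z] by auto
    also have "\<dots> \<le> max 1 B * exp \<bar>Im z\<bar>" by (intro mult_left_mono) auto
    finally show ?thesis .
  next
    case False
    then have "norm (csinc z) \<le> exp \<bar>Im z\<bar> / 1"
      unfolding csinc_def using norm_sin_le_exp[of z]
      by (auto simp: norm_divide simp del: div_by_1 intro!: frac_le)
    also have "\<dots> \<le> max 1 B * exp \<bar>Im z\<bar>" by simp
    finally show ?thesis .
  qed
  then show ?thesis by (intro that[of "max 1 B"]) auto
qed

lemma csinc_of_real: "csinc (of_real x) = of_real (sinc x)"
  by (simp add: csinc_def sin_of_real)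

lemma csinc_imaginary: "csinc (\<i> * of_real y) = of_real (if y = 0 then 1 else sinh y / y)"
proof -
  have "sin (\<i> * of_real y) = \<i> * of_real (sinh y)"
    by (simp add: sin_i_times sinh_field_def exp_minus flip: exp_of_real)
  then show ?thesis by (simp add: csinc_def)
qed

lemma sinh_ge_self: "x \<le> sinh x" if "0 \<le> x" for x :: real
  using real_le_x_sinh[OF that] by (simp add: sinh_field_def exp_minus)

text \<open>On the imaginary axis \<open>csinc\<close> is sinh y / y, and sinh y \<ge> y for y \<ge>
  0. The damping factor thus only enlarges the denominator of \<open>gap_kernel\<close>, which is
  what makes the bounds below uniform in \<open>d\<close>.\<close>

lemma norm_csinc_imaginary_ge_1: "1 \<le> norm (csinc (\<i> * of_real y))"
proof -
  have "1 \<le> sinh y / y" if "y \<noteq> 0"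
    using that sinh_ge_self[of y] sinh_ge_self[of "-y"]
    by (cases "y > 0") (auto simp: field_simps)
  then show ?thesis unfolding csinc_imaginary norm_of_real by (auto simp del: abs_divide)
qed

lemma norm_csinc_of_real_le:
  "norm (csinc (of_real x)) \<le> 1" "\<bar>x\<bar> * norm (csinc (of_real x)) \<le> 1"
proof -
  show "norm (csinc (of_real x)) \<le> 1"
    unfolding csinc_of_real using abs_sin_x_le_abs_x[of x] by auto
  show "\<bar>x\<bar> * norm (csinc (of_real x)) \<le> 1"
    unfolding csinc_of_real by auto
qed

text \<open>This is the function H of the overview. Writing the damping factor with
  \<open>csinc\<close> makes \<open>d = 0\<close> a legitimate value, at which the factor is 1; the
  limit d \<rightarrow> 0 is evaluated there.\<close>

definition bump :: "real \<Rightarrow> real \<Rightarrow> complex \<Rightarrow> complex" where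
  "bump s d z = (1 + of_real s * cos (2 * of_real pi * z)) / 2 * (csinc (of_real (pi * d) * z))\<^sup>2"

lemma bump_holomorphic: "bump s d holomorphic_on UNIV"
  unfolding bump_def
  by (intro holomorphic_intros
      holomorphic_on_compose_gen[OF _ csinc_holomorphic, unfolded o_def]) auto

lemma bump_minus: "bump s d (- z) = bump s d z"
  by (simp add: bump_def csinc_minus)

text \<open>The exponential types add up: 2 pi from the cosine, and pi d from each of the two
  factors \<open>csinc\<close>.\<close>

lemma bump_bound:
  assumes "d \<ge> 0" "\<bar>s\<bar> = 1"
  obtains C where "\<And>z. norm (bump s d z) \<le> C * exp (2 * pi * (1 + d) * \<bar>Im z\<bar>)"
proof -
  obtain B where B: "B \<ge> 0" "\<And>z. norm (csinc z) \<le> B * exp \<bar>Im z\<bar>"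
    using csinc_bound by blast
  have "norm (bump s d z) \<le> B\<^sup>2 * exp (2 * pi * (1 + d) * \<bar>Im z\<bar>)" for z
  proof -
    have "norm ((1 + of_real s * cos (2 * of_real pi * z)) / 2) \<le> (1 + exp \<bar>Im (2 * of_real pi * z)\<bar>) / 2"
      using norm_triangle_ineq[of 1 "of_real s * cos (2 * of_real pi * z)"] norm_cos_le_exp[of "2 * of_real pi * z"] assms
      by (simp add: norm_divide norm_mult)
    also have "\<dots> \<le> exp (2 * pi * \<bar>Im z\<bar>)"
      by (simp add: abs_mult)
    finally have 1: "norm ((1 + of_real s * cos (2 * of_real pi * z)) / 2) \<le> exp (2 * pi * \<bar>Im z\<bar>)" .
    have "norm (csinc (of_real (pi * d) * z)) \<le> B * exp (pi * d * \<bar>Im z\<bar>)"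
      using B(2)[of "of_real (pi * d) * z"] assms by (simp add: abs_mult)
    then have "norm ((csinc (of_real (pi * d) * z))\<^sup>2) \<le> (B * exp (pi * d * \<bar>Im z\<bar>))\<^sup>2"
      unfolding norm_power by (rule power_mono) auto
    from mult_mono[OF 1 this]
    have "norm (bump s d z) \<le> exp (2 * pi * \<bar>Im z\<bar>) * (B\<^sup>2 * (exp (pi * d * \<bar>Im z\<bar>))\<^sup>2)"
      unfolding bump_def norm_mult power_mult_distrib by simp
    also have "\<dots> = B\<^sup>2 * (exp (2 * pi * \<bar>Im z\<bar>) * exp (2 * (pi * d * \<bar>Im z\<bar>)))"
      unfolding exp_double by (simp only: mult_ac)
    also have "exp (2 * pi * \<bar>Im z\<bar>) * exp (2 * (pi * d * \<bar>Im z\<bar>)) = exp (2 * pi * (1 + d) * \<bar>Im z\<bar>)"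
      unfolding exp_add[symmetric] by (rule arg_cong[of _ _ exp]) (simp add: algebra_simps)
    finally show ?thesis .
  qed
  then show ?thesis by (rule that)
qed

lemma one_plus_sign_cos_nonneg:
  fixes s x :: real
  assumes "\<bar>s\<bar> = 1"
  shows "0 \<le> 1 + s * cos x"
proof -
  have "\<bar>s * cos x\<bar> \<le> 1" using assms by (simp add: abs_mult)
  then show ?thesis by linarith
qed

lemma bump_of_real_eq:
  "bump s d (of_real x) = of_real ((1 + s * cos (2 * pi * x)) / 2 * (sinc (pi * d * x))\<^sup>2)"
proof -
  have 1: "cos (2 * of_real pi * of_real x) = complex_of_real (cos (2 * pi * x))"
    using cos_of_real[of "2 * pi * x", where 'a = complex] by simp
  have 2: "csinc (of_real (pi * d) * of_real x) = of_real (sinc (pi * d * x))"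
    unfolding of_real_mult[symmetric] by (rule csinc_of_real)
  show ?thesis
    unfolding bump_def 1 2
    by (simp only: of_real_mult of_real_add of_real_divide of_real_power of_real_1 of_real_numeral)
qed

lemma norm_bump_of_real:
  assumes "\<bar>s\<bar> = 1"
  shows "norm (bump s d (of_real x)) = (1 + s * cos (2 * pi * x)) / 2 * (sinc (pi * d * x))\<^sup>2"
  unfolding bump_of_real_eq norm_of_real
  by (intro abs_of_nonneg mult_nonneg_nonneg divide_nonneg_nonneg one_plus_sign_cos_nonneg assms
      zero_le_power2) auto

text \<open>Being nonnegative on the real axis, \<open>bump\<close> may replace its norm in
  \<open>gap_kernel\<close>, and contour integration applies to it.\<close>

lemma bump_of_real:
  assumes "\<bar>s\<bar> = 1"
  shows "bump s d (of_real x) = of_real (norm (bump s d (of_real x)))"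
  unfolding norm_bump_of_real[OF assms] by (rule bump_of_real_eq)

lemma bump_imaginary_eq:
  "bump s d (\<i> * of_real l) = of_real ((1 + s * cosh (2 * pi * l)) / 2) * (csinc (\<i> * of_real (pi * d * l)))\<^sup>2"
proof -
  have "cos (2 * of_real pi * (\<i> * of_real l)) = complex_of_real (cosh (2 * pi * l))"
    using cos_i_times[of "complex_of_real (2 * pi * l)"]
    by (simp add: cosh_field_def exp_minus mult_ac flip: exp_of_real)
  then show ?thesis by (simp add: bump_def mult_ac)
qed

text \<open>Since s^2 = 1, (1 + s cosh)/2 equals s (cosh + s)/2, while the squared
  \<open>csinc\<close> factor is real and at least 1. The sign \<open>s\<close> at the point i l
  decides on which side the approximation lies, and the lower bound for the norm is free of
  \<open>d\<close>.\<close>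

lemma bump_imaginary:
  assumes "\<bar>s\<bar> = 1" "l \<noteq> 0"
  shows "bump s d (\<i> * of_real l) = of_real (s * norm (bump s d (\<i> * of_real l)))"
    and "norm (bump s d (\<i> * of_real l)) \<ge> (cosh (2 * pi * l) + s) / 2"
    and "(cosh (2 * pi * l) + s) / 2 > 0"
proof -
  define q where "q = (if pi * d * l = 0 then 1 else sinh (pi * d * l) / (pi * d * l))"
  have q: "csinc (\<i> * of_real (pi * d * l)) = of_real q"
    unfolding csinc_imaginary q_def ..
  have q1: "q\<^sup>2 \<ge> 1"
    using norm_csinc_imaginary_ge_1[of "pi * d * l"] unfolding q by (simp add: abs_le_square_iff[of 1 q, simplified])
  have "cosh (2 * pi * l) > 1"
    using cosh_real_ge_1[of "2 * pi * l"] cosh_real_one_iff[of "2 * pi * l"] assms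
    by (simp add: order_less_le)
  then show pos: "(cosh (2 * pi * l) + s) / 2 > 0" using assms by (auto simp: abs_if split: if_splits)
  have *: "bump s d (\<i> * of_real l) = of_real (s * ((cosh (2 * pi * l) + s) / 2 * q\<^sup>2))"
    unfolding bump_imaginary_eq q using assms by (auto simp: abs_if field_simps split: if_splits)
  have n: "norm (bump s d (\<i> * of_real l)) = (cosh (2 * pi * l) + s) / 2 * q\<^sup>2"
    unfolding * norm_of_real abs_mult using pos assms by simp
  show "bump s d (\<i> * of_real l) = of_real (s * norm (bump s d (\<i> * of_real l)))"
    unfolding n by (rule *)
  show "norm (bump s d (\<i> * of_real l)) \<ge> (cosh (2 * pi * l) + s) / 2"
    unfolding n using mult_left_mono[OF q1, of "(cosh (2 * pi * l) + s) / 2"] pos by simp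
qed

text \<open>In the second bound one sinc factor pays for \<bar>x\<bar>, by \<bar>y sinc y\<bar>
  \<le> 1 at y = pi d x, and the other is at most 1. The resulting 1/(pi d) is relaxed to
  1/d.\<close>

lemma norm_bump_of_real_le:
  assumes "\<bar>s\<bar> = 1"
  shows "norm (bump s d (of_real x)) \<le> (1 + s * cos (2 * pi * x)) / 2"
    and "d > 0 \<Longrightarrow> \<bar>x\<bar> * norm (bump s d (of_real x)) \<le> (1 + s * cos (2 * pi * x)) / 2 * (1 / d)"
proof -
  define c where "c = \<bar>sinc (pi * d * x)\<bar>"
  have pos: "(1 + s * cos (2 * pi * x)) / 2 \<ge> 0"
    using one_plus_sign_cos_nonneg[OF assms] by simp
  have n: "norm (bump s d (of_real x)) = (1 + s * cos (2 * pi * x)) / 2 * c\<^sup>2"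
    unfolding norm_bump_of_real[OF assms] c_def power2_abs ..
  have c: "0 \<le> c" "c \<le> 1" "\<bar>pi * d * x\<bar> * c \<le> 1"
    unfolding c_def using norm_csinc_of_real_le[of "pi * d * x"] unfolding csinc_of_real norm_of_real by auto
  show "norm (bump s d (of_real x)) \<le> (1 + s * cos (2 * pi * x)) / 2"
    unfolding n using mult_left_mono[OF power_le_one[OF c(1,2), of 2] pos] by simp
  assume d: "d > 0"
  have "d * \<bar>x\<bar> * c \<le> pi * d * \<bar>x\<bar> * c"
    using pi_gt3 d c(1) by (intro mult_right_mono) auto
  also have "\<dots> \<le> 1" using c(3) d by (simp add: abs_mult)
  finally have "d * \<bar>x\<bar> * c * c \<le> 1"
    using c by (meson mult_le_one mult_nonneg_nonneg abs_ge_zero less_imp_le d)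
  then have "\<bar>x\<bar> * c\<^sup>2 \<le> 1 / d"
    using d by (simp add: field_simps power2_eq_square)
  from mult_left_mono[OF this pos]
  show "\<bar>x\<bar> * norm (bump s d (of_real x)) \<le> (1 + s * cos (2 * pi * x)) / 2 * (1 / d)"
    unfolding n by (simp only: mult_ac)
qed

lemma measurable_bump_of_real [measurable]: "(\<lambda>x. bump s d (of_real x)) \<in> borel_measurable borel"
  and measurable_bump_imaginary [measurable]: "(\<lambda>x. bump s d (\<i> * of_real x)) \<in> borel_measurable borel"
  by (intro borel_measurable_continuous_onI continuous_intros
      continuous_on_compose2[OF holomorphic_on_imp_continuous_on[OF bump_holomorphic]]; simp)+

section \<open>One-sided approximation of a kink\<close>

text \<open>
  \<open>gap s d\<close> is \<open>s\<close> times the error of the one-sided approximation of \<open>\<bar>x\<bar>\<close>, so that its Fourier transform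
  at high frequencies \<open>t\<close> is \<open>s / (2 \<pi>\<^sup>2 t\<^sup>2)\<close>, that is \<open>- s\<close> times the one of \<open>\<bar>x\<bar>\<close>.
\<close>

definition gap_kernel :: "real \<Rightarrow> real \<Rightarrow> real \<Rightarrow> real \<Rightarrow> real" where
  "gap_kernel s d x l = indicator {0<..} l *
     (2 / pi * l\<^sup>2 * norm (bump s d (of_real x)) / (norm (bump s d (\<i> * of_real l)) * (x\<^sup>2 + l\<^sup>2)))"

definition gap :: "real \<Rightarrow> real \<Rightarrow> real \<Rightarrow> real" where
  "gap s d x = (LINT l|lborel. gap_kernel s d x l)"

text \<open>An integrable majorant of \<open>gap_kernel\<close> that depends neither on
  \<open>s\<close> nor on \<open>d\<close>. The 17 is the constant of
  \<open>bump_ratio_bound\<close>.\<close>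

definition kernel_bound :: "real \<Rightarrow> real \<Rightarrow> real" where
  "kernel_bound x l = 1 / (1 + x\<^sup>2) * (17 * (indicator {0<..} l * exp (- (pi * l))))"

lemma measurable_gap_kernel [measurable]:
  "(\<lambda>(x, l). gap_kernel s d x l) \<in> borel_measurable (lborel \<Otimes>\<^sub>M lborel)"
  unfolding gap_kernel_def by measurable

lemma measurable_kernel_bound [measurable]:
  "(\<lambda>(x, l). kernel_bound x l) \<in> borel_measurable (lborel \<Otimes>\<^sub>M lborel)"
  unfolding kernel_bound_def by measurable

lemma measurable_gap [measurable]: "gap s d \<in> borel_measurable borel"
  unfolding gap_def by measurable

lemma gap_kernel_nonneg: "0 \<le> gap_kernel s d x l"
  by (simp add: gap_kernel_def)

lemma gap_nonneg: "0 \<le> gap s d x"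
  unfolding gap_def by (intro Bochner_Integration.integral_nonneg gap_kernel_nonneg)

section \<open>Bounds for the kernel and its integral, uniform in d\<close>

text \<open>For s = 1 the factor (cosh + 1)/2 stays away from 0 and its growth exp(2 pi l) absorbs
  both 1 + l^2 and exp(pi l). For s = -1 the two factors are sin^2(pi x) and sinh^2(pi l): the zero
  of the second at l = 0 is matched by \<open>l\<^sup>2\<close>, and the zero of x^2 + l^2 at the
  origin by sin^2(pi x) \<le> 16 x^2. With sin^2 \<le> 1 this gives 17 = 16 + 1.\<close>

lemma bump_ratio_bound:
  fixes s x l :: real
  assumes s: "\<bar>s\<bar> = 1" and l: "l > 0"
  shows "l\<^sup>2 * ((1 + s * cos (2 * pi * x)) / 2) * (1 + x\<^sup>2)
     \<le> 17 * exp (- (pi * l)) * ((cosh (2 * pi * l) + s) / 2) * (x\<^sup>2 + l\<^sup>2)"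
proof -
  consider "s = 1" | "s = -1" using s by linarith
  then show ?thesis
  proof cases
    case 1
    have "(1 + l\<^sup>2) \<le> (1 + l)\<^sup>2" using l by (simp add: power2_eq_square algebra_simps)
    also have "\<dots> \<le> (exp l)\<^sup>2" using l by (intro power_mono exp_ge_add_one_self) auto
    also have "\<dots> = exp (2 * l)" by (simp add: exp_double)
    also have "\<dots> \<le> exp (pi * l)" using l pi_gt3 by simp
    also have "\<dots> = exp (- (pi * l)) * exp (2 * pi * l)"
      by (simp flip: exp_add)
    also have "\<dots> \<le> exp (- (pi * l)) * (4 * ((cosh (2 * pi * l) + s) / 2))"
      using 1 by (intro mult_left_mono) (auto simp: cosh_field_def add_divide_distrib add_nonneg_nonneg)
    also have "\<dots> \<le> 17 * exp (- (pi * l)) * ((cosh (2 * pi * l) + s) / 2)"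
      using 1 by (simp add: add_nonneg_nonneg)
    finally have a: "1 + l\<^sup>2 \<le> 17 * exp (- (pi * l)) * ((cosh (2 * pi * l) + s) / 2)" .
    have "l\<^sup>2 * ((1 + s * cos (2 * pi * x)) / 2) * (1 + x\<^sup>2) \<le> l\<^sup>2 * 1 * (1 + x\<^sup>2)"
      using 1 by (intro mult_right_mono mult_left_mono) auto
    also have "\<dots> \<le> (1 + l\<^sup>2) * (x\<^sup>2 + l\<^sup>2)"
      by (simp add: algebra_simps)
    also have "\<dots> \<le> 17 * exp (- (pi * l)) * ((cosh (2 * pi * l) + s) / 2) * (x\<^sup>2 + l\<^sup>2)"
      by (intro mult_right_mono a) auto
    finally show ?thesis .
  next
    case 2
    define u where "u = pi * l"
    have u: "u > 0" "2 * pi * l = 2 * u" using l by (auto simp: u_def)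
    \<comment> \<open>Splitting sinh u = 2 sinh(u/2) cosh(u/2) allows a linear bound for one factor
      and an exponential bound for the other; after squaring, half of the growth exp(2u) is kept as
      exp u.\<close>
    have "u / 2 * exp (u / 2) \<le> sinh (u / 2) * exp (u / 2)"
      using u by (intro mult_right_mono sinh_ge_self) auto
    also have "\<dots> \<le> sinh (u / 2) * (2 * cosh (u / 2))"
      using u by (intro mult_left_mono) (auto simp: cosh_field_def)
    also have "\<dots> = sinh u"
      using sinh_double[of "u / 2"] by simp
    finally have "(u / 2 * exp (u / 2))\<^sup>2 \<le> (sinh u)\<^sup>2"
      using u by (intro power_mono) auto
    also have "(u / 2 * exp (u / 2))\<^sup>2 = u\<^sup>2 / 4 * exp u"
      using exp_double[of "u / 2"] by (simp add: power_mult_distrib power_divide)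
    finally have "u\<^sup>2 / 4 * exp u * exp (- u) \<le> (sinh u)\<^sup>2 * exp (- u)"
      by (intro mult_right_mono) auto
    then have "u\<^sup>2 / 4 \<le> (sinh u)\<^sup>2 * exp (- u)"
      by (simp add: exp_minus field_simps)
    moreover have "l\<^sup>2 * 9 \<le> u\<^sup>2"
      unfolding u_def power_mult_distrib
      using pi_gt3 power_mono[of 3 pi 2] mult_right_mono[of 9 "pi\<^sup>2" "l\<^sup>2"] by (simp add: mult.commute)
    ultimately have a: "l\<^sup>2 \<le> (sinh u)\<^sup>2 * exp (- u)"
      using zero_le_power2[of l] by linarith
    have "\<bar>sin (pi * x)\<bar> \<le> \<bar>pi * x\<bar>" by (rule abs_sin_x_le_abs_x)
    then have "(sin (pi * x))\<^sup>2 \<le> (pi * x)\<^sup>2" by (simp add: abs_le_square_iff)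
    also have "\<dots> \<le> 16 * x\<^sup>2"
      unfolding power_mult_distrib using pi_less_4 power_mono[of pi 4 2] by (intro mult_right_mono) auto
    finally have b1: "(sin (pi * x))\<^sup>2 \<le> 16 * x\<^sup>2" .
    have b2: "(sin (pi * x))\<^sup>2 * x\<^sup>2 \<le> 1 * x\<^sup>2"
      by (intro mult_right_mono) (auto simp: abs_square_le_1)
    have b: "(sin (pi * x))\<^sup>2 * (1 + x\<^sup>2) \<le> 17 * (x\<^sup>2 + l\<^sup>2)"
      unfolding distrib_left using b1 b2 zero_le_power2[of l] by linarith
    have c: "(1 + s * cos (2 * pi * x)) / 2 = (sin (pi * x))\<^sup>2"
      using cos_double_sin[of "pi * x"] 2 by (simp add: mult_ac)
    have d: "(cosh (2 * pi * l) + s) / 2 = (sinh u)\<^sup>2"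
      unfolding u(2) cosh_double_cosh sinh_square_eq using 2 by simp
    have "l\<^sup>2 * ((sin (pi * x))\<^sup>2 * (1 + x\<^sup>2)) \<le> ((sinh u)\<^sup>2 * exp (- u)) * (17 * (x\<^sup>2 + l\<^sup>2))"
      by (rule mult_mono[OF a b]) auto
    then show ?thesis unfolding c d u_def[symmetric] by (simp only: mult_ac)
  qed
qed

text \<open>The weight \<open>a\<close> and its price \<open>M\<close> are left open so that one
  computation serves both the plain bound (a = M = 1) and the first-moment bound (a = \<bar>x\<bar>,
  M = 1/d).\<close>

lemma weighted_gap_kernel_le:
  assumes s: "\<bar>s\<bar> = 1" and "M \<ge> 0"
    and N: "a * norm (bump s d (of_real x)) \<le> (1 + s * cos (2 * pi * x)) / 2 * M"
  shows "a * gap_kernel s d x l \<le> M * kernel_bound x l"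
proof (cases "l > 0")
  case l: True
  define n where "n = norm (bump s d (\<i> * of_real l))"
  define k where "k = (cosh (2 * pi * l) + s) / 2"
  define h where "h = (1 + s * cos (2 * pi * x)) / 2"
  have k: "0 < k" "k \<le> n"
    using bump_imaginary(2)[OF s, of l d] bump_imaginary(3)[OF s, of l] l unfolding n_def k_def by auto
  have h: "0 \<le> h" using one_plus_sign_cos_nonneg[OF s] unfolding h_def by simp
  have p: "x\<^sup>2 + l\<^sup>2 > 0" "1 + x\<^sup>2 > 0"
    using l by (auto intro: add_nonneg_pos add_pos_nonneg)
  have "a * gap_kernel s d x l = (2 / pi) * (l\<^sup>2 * (a * norm (bump s d (of_real x))) / (n * (x\<^sup>2 + l\<^sup>2)))"
    using l by (simp add: gap_kernel_def n_def)
  also have "\<dots> \<le> (2 / pi) * (l\<^sup>2 * (h * M) / (n * (x\<^sup>2 + l\<^sup>2)))"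
    using k p N unfolding h_def by (intro mult_left_mono divide_right_mono) auto
  also have "\<dots> \<le> 1 * (l\<^sup>2 * (h * M) / (n * (x\<^sup>2 + l\<^sup>2)))"
    using k p h \<open>M \<ge> 0\<close> pi_gt3 by (intro mult_right_mono) auto
  also have "\<dots> \<le> 1 * (l\<^sup>2 * (h * M) / (k * (x\<^sup>2 + l\<^sup>2)))"
    using k p h \<open>M \<ge> 0\<close> by (intro mult_left_mono divide_left_mono mult_right_mono) auto
  also have "\<dots> = (l\<^sup>2 * h * (1 + x\<^sup>2)) * M / (k * (x\<^sup>2 + l\<^sup>2) * (1 + x\<^sup>2))"
    using k p by (simp add: divide_simps)
  also have "\<dots> \<le> (17 * exp (- (pi * l)) * k * (x\<^sup>2 + l\<^sup>2)) * M / (k * (x\<^sup>2 + l\<^sup>2) * (1 + x\<^sup>2))"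
    using bump_ratio_bound[OF s l, of x] k p \<open>M \<ge> 0\<close> unfolding k_def h_def
    by (intro divide_right_mono mult_right_mono) auto
  also have "\<dots> = M * kernel_bound x l"
    using k p l by (simp add: kernel_bound_def divide_simps)
  finally show ?thesis .
qed (simp add: gap_kernel_def kernel_bound_def)

lemma gap_kernel_le:
  assumes "\<bar>s\<bar> = 1"
  shows "gap_kernel s d x l \<le> kernel_bound x l"
    and "d > 0 \<Longrightarrow> \<bar>x\<bar> * gap_kernel s d x l \<le> 1 / d * kernel_bound x l"
  using weighted_gap_kernel_le[OF assms, of 1 1 d x l] weighted_gap_kernel_le[OF assms, of "1 / d" "\<bar>x\<bar>" d x l]
    norm_bump_of_real_le[OF assms, of d x] by auto

lemma has_bochner_integral_exp_scaled:
  assumes "u > 0"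
  shows "has_bochner_integral lborel (\<lambda>l::real. indicator {0<..} l * (l ^ k * exp (- (u * l)))) (fact k / u ^ Suc k)"
proof -
  have "has_bochner_integral lborel
      (\<lambda>x. (0 + u * x) ^ k * exp (- (0 + u * x)) * indicator {0 <..} (0 + u * x)) (fact k /\<^sub>R \<bar>u\<bar>)"
    using has_bochner_integral_I0i_power_exp_m[of k] assms
    by (subst lborel_has_bochner_integral_real_affine_iff[of u _ _ 0, symmetric]) auto
  from has_bochner_integral_mult_right[OF this, of "1 / u ^ k"]
  show ?thesis
    by (rule has_bochner_integral_cong[THEN iffD1, rotated 3])
       (use assms in \<open>auto simp: indicator_def zero_less_mult_iff power_mult_distrib field_simps\<close>)
qed

lemma has_bochner_integral_inverse_1_plus_square:
  "has_bochner_integral lborel (\<lambda>x::real. 1 / (1 + x\<^sup>2)) pi"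
  using has_bochner_integral_Poisson_kernel[of 1] by (simp add: add.commute)

lemma has_bochner_integral_kernel_bound:
  "has_bochner_integral lborel (kernel_bound x) (17 / pi * (1 / (1 + x\<^sup>2)))"
  unfolding kernel_bound_def
  using has_bochner_integral_mult_right[OF has_bochner_integral_mult_right[OF has_bochner_integral_exp_scaled[of pi 0], of 17], of "1 / (1 + x\<^sup>2)"]
  by (simp add: mult_ac)

text \<open>This single majorant on the plane justifies every exchange of the two integrations and
  the passage to the limit d \<rightarrow> 0.\<close>

lemma integrable_kernel_bound: "integrable (lborel \<Otimes>\<^sub>M lborel) (\<lambda>(x, l). kernel_bound x l)"
proof (rule lborel_pair.Fubini_integrable)
  have "kernel_bound x l \<ge> 0" for x l by (simp add: kernel_bound_def)
  then have "(LINT l|lborel. norm (kernel_bound x l)) = 17 / pi * (1 / (1 + x\<^sup>2))" for x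
    using has_bochner_integral_kernel_bound[of x] by (simp add: has_bochner_integral_iff)
  then show "integrable lborel (\<lambda>x. LINT l|lborel. norm (case (x, l) of (x, l) \<Rightarrow> kernel_bound x l))"
    using has_bochner_integral_mult_right[OF has_bochner_integral_inverse_1_plus_square, of "17 / pi"]
    by (simp add: has_bochner_integral_iff)
  show "AE x in lborel. integrable lborel (\<lambda>l. case (x, l) of (x, l) \<Rightarrow> kernel_bound x l)"
    using has_bochner_integral_kernel_bound by (simp add: has_bochner_integral_iff)
qed measurable

lemma integrable_gap_kernel:
  assumes "\<bar>s\<bar> = 1"
  shows "integrable lborel (gap_kernel s d x)"
proof (rule Bochner_Integration.integrable_bound)
  show "integrable lborel (kernel_bound x)"
    using has_bochner_integral_kernel_bound by (simp add: has_bochner_integral_iff)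
  show "AE l in lborel. norm (gap_kernel s d x l) \<le> norm (kernel_bound x l)"
    using gap_kernel_le(1)[OF assms, of d x] gap_kernel_nonneg[of s d x]
    by (intro AE_I2) (simp add: order_trans[OF _ abs_ge_self])
qed measurable

text \<open>Integration of the pointwise bounds over \<open>l\<close>. The second one is the gain
  from the damping factor: decay of order \<bar>x\<bar>^-3 instead of x^-2, at the cost of
  1/d.\<close>

lemma gap_le:
  assumes s: "\<bar>s\<bar> = 1"
  shows "gap s d x \<le> 17 / pi * (1 / (1 + x\<^sup>2))"
    and "d > 0 \<Longrightarrow> \<bar>x\<bar> * gap s d x \<le> 1 / d * (17 / pi * (1 / (1 + x\<^sup>2)))"
proof -
  have m: "integrable lborel (kernel_bound x)" "17 / pi * (1 / (1 + x\<^sup>2)) = integral\<^sup>L lborel (kernel_bound x)"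
    using has_bochner_integral_kernel_bound by (simp_all add: has_bochner_integral_iff)
  show "gap s d x \<le> 17 / pi * (1 / (1 + x\<^sup>2))"
    unfolding m(2) gap_def using gap_kernel_le(1)[OF s]
    by (intro integral_mono integrable_gap_kernel m s) auto
  show "\<bar>x\<bar> * gap s d x \<le> 1 / d * (17 / pi * (1 / (1 + x\<^sup>2)))" if "d > 0"
    unfolding m(2) gap_def integral_mult_right_zero[symmetric]
    using gap_kernel_le(2)[OF s that]
    by (intro integral_mono integrable_mult_right integrable_gap_kernel m s) auto
qed

lemma integrable_gap:
  assumes "\<bar>s\<bar> = 1"
  shows "integrable lborel (gap s d)"
proof (rule Bochner_Integration.integrable_bound)
  show "integrable lborel (\<lambda>x::real. 17 / pi * (1 / (1 + x\<^sup>2)))"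
    using has_bochner_integral_mult_right[OF has_bochner_integral_inverse_1_plus_square, of "17 / pi"]
    by (simp add: has_bochner_integral_iff)
  show "AE x in lborel. norm (gap s d x) \<le> norm (17 / pi * (1 / (1 + x\<^sup>2)))"
    using gap_le(1)[OF assms, of d] gap_nonneg[of s d]
    by (intro AE_I2) (simp add: order_trans[OF _ abs_ge_self])
qed measurable

lemma gap_moment:
  assumes s: "\<bar>s\<bar> = 1" and d: "d > 0"
  shows "integrable lborel (\<lambda>x. \<bar>x\<bar> * gap s d x)"
    and "(LINT x|lborel. \<bar>x\<bar> * gap s d x) \<le> 17 / d"
proof -
  have m: "has_bochner_integral lborel (\<lambda>x::real. 1 / d * (17 / pi * (1 / (1 + x\<^sup>2)))) (17 / d)"
    using has_bochner_integral_mult_right[OF has_bochner_integral_mult_right[OF has_bochner_integral_inverse_1_plus_square, of "17 / pi"], of "1 / d"]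
    by simp
  show i: "integrable lborel (\<lambda>x. \<bar>x\<bar> * gap s d x)"
  proof (rule Bochner_Integration.integrable_bound)
    show "integrable lborel (\<lambda>x::real. 1 / d * (17 / pi * (1 / (1 + x\<^sup>2))))"
      using m by (simp add: has_bochner_integral_iff)
    show "AE x in lborel. norm (\<bar>x\<bar> * gap s d x) \<le> norm (1 / d * (17 / pi * (1 / (1 + x\<^sup>2))))"
    proof (rule AE_I2)
      fix x
      have "norm (\<bar>x\<bar> * gap s d x) = \<bar>x\<bar> * gap s d x"
        using gap_nonneg[of s d x] by simp
      also have "\<dots> \<le> norm (1 / d * (17 / pi * (1 / (1 + x\<^sup>2))))"
        unfolding real_norm_def by (rule order_trans[OF gap_le(2)[OF s d] abs_ge_self])
      finally show "norm (\<bar>x\<bar> * gap s d x) \<le> norm (1 / d * (17 / pi * (1 / (1 + x\<^sup>2))))" .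
    qed
  qed measurable
  show "(LINT x|lborel. \<bar>x\<bar> * gap s d x) \<le> 17 / d"
    using m gap_le(2)[OF s d] i
    unfolding has_bochner_integral_iff by (metis (no_types, lifting) integral_mono)
qed

section \<open>Fourier transform of the error at high frequencies\<close>

lemma lborel_integral_reflect:
  fixes f :: "real \<Rightarrow> 'a :: {banach, second_countable_topology}"
  shows "(LINT x|lborel. f (- x)) = (LINT x|lborel. f x)"
  using lborel_integral_real_affine[of "-1" f 0] by simp

lemma norm_bump_imaginary_pos:
  assumes "\<bar>s\<bar> = 1" "l \<noteq> 0"
  shows "0 < norm (bump s d (\<i> * of_real l))"
  using bump_imaginary(2)[OF assms, of d] bump_imaginary(3)[OF assms] by linarith

text \<open>In the upper half-plane the character has modulus exp(2 pi t Im z), which for t \<le>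
  -(1 + d) outweighs the growth of \<open>bump\<close>. The product is bounded there, as the Poisson
  formula requires.\<close>

lemma bump_Poisson_formula_nonpos:
  assumes s: "\<bar>s\<bar> = 1" and d: "d \<ge> 0" and l: "l > 0" and t: "t \<le> - (1 + d)"
  shows "(LINT x|lborel. bump s d (of_real x) * exp (- (2 * of_real pi * \<i> * of_real x * of_real t))
             / complex_of_real (x\<^sup>2 + l\<^sup>2))
         = of_real (pi / l) * (bump s d (\<i> * of_real l) * of_real (exp (- (2 * pi * \<bar>t\<bar> * l))))"
proof -
  obtain C where C: "\<And>z. norm (bump s d z) \<le> C * exp (2 * pi * (1 + d) * \<bar>Im z\<bar>)"
    using bump_bound[OF d s] by blast
  define F where "F = (\<lambda>z. bump s d z * exp (- (2 * of_real pi * \<i> * z * of_real t)))"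
  have "F holomorphic_on UNIV"
    unfolding F_def by (intro holomorphic_intros bump_holomorphic)
  moreover have "norm (F z) \<le> C" if z: "Im z \<ge> 0" for z
  proof -
    have "C \<ge> 0" using C[of 0] norm_ge_zero[of "bump s d 0"] by (simp del: norm_ge_zero)
    have "norm (F z) \<le> C * exp (2 * pi * (1 + d) * \<bar>Im z\<bar>) * exp (2 * pi * t * Im z)"
      unfolding F_def norm_mult using \<open>C \<ge> 0\<close> by (intro mult_mono C) (auto simp: mult_ac)
    also have "\<dots> = C * exp ((2 * pi * Im z) * (1 + d + t))"
      using z by (simp add: algebra_simps flip: exp_add)
    also have "\<dots> \<le> C * 1"
      using z t \<open>C \<ge> 0\<close> by (intro mult_left_mono) (auto simp: mult_nonneg_nonpos)
    finally show ?thesis by simp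
  qed
  ultimately have "(LINT x|lborel. F (of_real x) / complex_of_real (x\<^sup>2 + l\<^sup>2)) = of_real (pi / l) * F (\<i> * of_real l)"
    by (rule Poisson_formula_half_plane[OF _ l])
  moreover have "exp (- (2 * of_real pi * \<i> * (\<i> * of_real l) * of_real t)) = complex_of_real (exp (- (2 * pi * \<bar>t\<bar> * l)))"
    using t d unfolding exp_of_real[symmetric] by (intro arg_cong[of _ _ exp]) (simp add: mult_ac)
  ultimately show ?thesis
    by (simp add: F_def del: of_real_add of_real_power)
qed

text \<open>Positive frequencies are reduced to negative ones by the substitution of -x for x,
  because \<open>bump\<close> is even.\<close>

lemma bump_Poisson_formula:
  assumes s: "\<bar>s\<bar> = 1" and d: "d \<ge> 0" and l: "l > 0" and t: "1 + d \<le> \<bar>t\<bar>"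
  shows "(LINT x|lborel. bump s d (of_real x) * exp (- (2 * of_real pi * \<i> * of_real x * of_real t))
             / complex_of_real (x\<^sup>2 + l\<^sup>2))
         = of_real (pi / l) * (bump s d (\<i> * of_real l) * of_real (exp (- (2 * pi * \<bar>t\<bar> * l))))"
proof (cases "t \<le> 0")
  case True
  then show ?thesis using bump_Poisson_formula_nonpos[OF s d l, of t] t by simp
next
  case False
  then show ?thesis
    using bump_Poisson_formula_nonpos[OF s d l, of "-t"] t
      lborel_integral_reflect[of "\<lambda>x. bump s d (of_real x) * exp (- (2 * of_real pi * \<i> * of_real x * of_real t))
             / complex_of_real (x\<^sup>2 + l\<^sup>2)"]
    by (simp add: bump_minus)
qed

text \<open>The Poisson formula produces the value of \<open>bump\<close> at i l, and the
  normalisation of \<open>gap_kernel\<close> divides by its norm. Only the sign \<open>s\<close>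
  survives, so the result is independent of \<open>d\<close>.\<close>

lemma gap_kernel_fourier:
  assumes s: "\<bar>s\<bar> = 1" and d: "d \<ge> 0" and l: "l > 0" and t: "1 + d \<le> \<bar>t\<bar>"
  shows "(LINT x|lborel. complex_of_real (gap_kernel s d x l) * exp (- (2 * of_real pi * \<i> * of_real x * of_real t)))
         = of_real (2 * s * (l * exp (- (2 * pi * \<bar>t\<bar> * l))))"
proof -
  define n where "n = norm (bump s d (\<i> * of_real l))"
  have n: "n > 0"
    unfolding n_def using norm_bump_imaginary_pos[OF s] l by simp
  define c where "c = 2 / pi * l\<^sup>2 / n"
  have "complex_of_real (gap_kernel s d x l) * e = of_real c * (bump s d (of_real x) * e / complex_of_real (x\<^sup>2 + l\<^sup>2))" for x e
    using l by (subst bump_of_real[OF s]) (simp add: gap_kernel_def n_def c_def mult_ac del: of_real_add of_real_power)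
  then have "(LINT x|lborel. complex_of_real (gap_kernel s d x l) * exp (- (2 * of_real pi * \<i> * of_real x * of_real t)))
     = of_real c * (of_real (pi / l) * (bump s d (\<i> * of_real l) * of_real (exp (- (2 * pi * \<bar>t\<bar> * l)))))"
    by (simp only: integral_mult_right_zero bump_Poisson_formula[OF s d l t])
  also have "\<dots> = of_real (c * (pi / l * (s * n * exp (- (2 * pi * \<bar>t\<bar> * l)))))"
    by (subst bump_imaginary(1)[OF s]) (use l in \<open>auto simp: n_def\<close>)
  also have "c * (pi / l * (s * n * exp (- (2 * pi * \<bar>t\<bar> * l)))) = 2 * s * (l * exp (- (2 * pi * \<bar>t\<bar> * l)))"
    using n l by (simp add: c_def power2_eq_square)
  finally show ?thesis .
qed

text \<open>By Fubini it remains to integrate 2 s l exp(-2 pi \<bar>t\<bar> l) over l > 0, which is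
  2 s / (2 pi \<bar>t\<bar>)^2.\<close>

lemma gap_fourier:
  assumes s: "\<bar>s\<bar> = 1" and d: "d \<ge> 0" and t: "1 + d \<le> \<bar>t\<bar>"
  shows "(LINT x|lborel. complex_of_real (gap s d x) * exp (- (2 * of_real pi * \<i> * of_real x * of_real t)))
         = of_real (s / (2 * pi\<^sup>2 * t\<^sup>2))"
proof -
  define E where "E = (\<lambda>x. exp (- (2 * complex_of_real pi * \<i> * of_real x * of_real t)))"
  have E: "norm (E x) = 1" for x unfolding E_def by simp
  have [measurable]: "E \<in> borel_measurable borel"
    unfolding E_def by (intro borel_measurable_continuous_onI continuous_intros)
  have i: "integrable (lborel \<Otimes>\<^sub>M lborel) (\<lambda>(x, l). complex_of_real (gap_kernel s d x l) * E x)"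
  proof (rule Bochner_Integration.integrable_bound[OF integrable_kernel_bound])
    show "AE z in lborel \<Otimes>\<^sub>M lborel. norm (case z of (x, l) \<Rightarrow> complex_of_real (gap_kernel s d x l) * E x)
        \<le> norm (case z of (x, l) \<Rightarrow> kernel_bound x l)"
      using gap_kernel_le(1)[OF s, of d] gap_kernel_nonneg[of s d]
      by (intro AE_I2) (auto simp: norm_mult E intro: order_trans[OF _ abs_ge_self])
  qed measurable
  have "(LINT x|lborel. complex_of_real (gap s d x) * E x)
      = (LINT x|lborel. LINT l|lborel. complex_of_real (gap_kernel s d x l) * E x)"
    unfolding gap_def by (simp flip: integral_complex_of_real)
  also have "\<dots> = (LINT l|lborel. LINT x|lborel. complex_of_real (gap_kernel s d x l) * E x)"
    by (rule lborel_pair.Fubini_integral[OF i, symmetric])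
  also have "\<dots> = (LINT l|lborel. of_real (indicator {0<..} l * (2 * s * (l * exp (- (2 * pi * \<bar>t\<bar> * l))))))"
  proof (rule Bochner_Integration.integral_cong[OF refl])
    fix l :: real
    show "(LINT x|lborel. complex_of_real (gap_kernel s d x l) * E x)
        = of_real (indicator {0<..} l * (2 * s * (l * exp (- (2 * pi * \<bar>t\<bar> * l)))))"
    proof (cases "l > 0")
      case True
      then show ?thesis unfolding E_def gap_kernel_fourier[OF s d True t] by simp
    qed (simp add: gap_kernel_def)
  qed
  also have "\<dots> = of_real (LINT l|lborel. 2 * s * (indicator {0<..} l * (l ^ 1 * exp (- (2 * pi * \<bar>t\<bar> * l)))))"
    unfolding integral_complex_of_real by (simp add: mult_ac)
  also have "(LINT l|lborel. 2 * s * (indicator {0<..} l * (l ^ 1 * exp (- (2 * pi * \<bar>t\<bar> * l)))))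
      = 2 * s * (1 / (2 * pi * \<bar>t\<bar>)\<^sup>2)"
    using has_bochner_integral_exp_scaled[of "2 * pi * \<bar>t\<bar>" 1] t d
    unfolding integral_mult_right_zero
    by (auto simp: has_bochner_integral_iff power2_eq_square)
  also have "\<dots> = s / (2 * pi\<^sup>2 * t\<^sup>2)"
    by (simp add: power_mult_distrib)
  finally show ?thesis unfolding E_def .
qed

section \<open>Total mass of the error and its limit\<close>

text \<open>The cosine is unbounded in the upper half-plane, so it is replaced by exp(2 pi i z),
  which has the same real part on the axis and is bounded there. With q = exp(-2 pi l) the Poisson
  formula yields the factor (1 + s q)/2, while (cosh + s)/2 = (1 + s q)^2 / (4 q); one factor 1 + s
  q cancels.\<close>

lemma gap_kernel_zero_integral:
  assumes s: "\<bar>s\<bar> = 1" and l: "l > 0"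
  shows "(LINT x|lborel. gap_kernel s 0 x l) = 4 * l * exp (- (2 * pi * l)) / (1 + s * exp (- (2 * pi * l)))"
proof -
  define q where "q = exp (- (2 * pi * l))"
  define F where "F = (\<lambda>z. (1 + of_real s * exp (2 * of_real pi * \<i> * z)) / 2)"
  have q: "0 < q" "q < 1" using l by (auto simp: q_def)
  have sq: "s * s = 1" using s by (metis abs_mult_self_eq mult_1)
  have pos: "1 + s * q > 0" using s q by (auto simp: abs_if split: if_splits)
  have k: "(cosh (2 * pi * l) + s) / 2 = (1 + s * q)\<^sup>2 / (4 * q)"
    using q sq by (simp add: cosh_field_def q_def exp_minus field_simps power2_eq_square)
  have bound: "norm (F z) \<le> 1" if "Im z \<ge> 0" for z
  proof -
    have "norm (of_real s * exp (2 * of_real pi * \<i> * z)) \<le> 1"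
      using s that by (simp add: norm_mult)
    then show ?thesis
      using norm_triangle_ineq[of 1 "of_real s * exp (2 * of_real pi * \<i> * z)"]
      unfolding F_def by (simp add: norm_divide)
  qed
  have hol: "F holomorphic_on UNIV"
    unfolding F_def by (intro holomorphic_intros) auto
  have [measurable]: "(\<lambda>x. F (of_real x)) \<in> borel_measurable borel"
    unfolding F_def by (intro borel_measurable_continuous_onI continuous_intros) auto
  have int: "integrable lborel (\<lambda>x. F (of_real x) / complex_of_real (x\<^sup>2 + l\<^sup>2))"
    by (rule integrable_bounded_times_Poisson_kernel[OF l, where C = 1]) (auto intro: bound)
  have Re: "Re (F (of_real x) / complex_of_real (x\<^sup>2 + l\<^sup>2)) = (1 + s * cos (2 * pi * x)) / 2 / (x\<^sup>2 + l\<^sup>2)" for x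
    unfolding Re_divide_of_real by (simp add: F_def Re_exp mult_ac)
  have "(LINT x|lborel. (1 + s * cos (2 * pi * x)) / 2 / (x\<^sup>2 + l\<^sup>2))
      = Re (LINT x|lborel. F (of_real x) / complex_of_real (x\<^sup>2 + l\<^sup>2))"
    unfolding integral_Re[OF int, symmetric] Re ..
  also have "\<dots> = Re (of_real (pi / l) * F (\<i> * of_real l))"
    by (subst Poisson_formula_half_plane[OF hol l bound]) auto
  also have "F (\<i> * of_real l) = of_real ((1 + s * q) / 2)"
    by (simp add: F_def q_def exp_of_real[symmetric] mult_ac del: exp_of_real)
  also have "Re (of_real (pi / l) * of_real ((1 + s * q) / 2)) = pi / l * ((1 + s * q) / 2)"
    by (simp flip: of_real_mult)
  finally have I: "(LINT x|lborel. (1 + s * cos (2 * pi * x)) / 2 / (x\<^sup>2 + l\<^sup>2)) = pi / l * ((1 + s * q) / 2)" .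
  have n: "norm (bump s 0 (\<i> * of_real l)) = (1 + s * q)\<^sup>2 / (4 * q)"
  proof -
    have "bump s 0 (\<i> * of_real l) = of_real ((1 + s * cosh (2 * pi * l)) / 2)"
      unfolding bump_imaginary_eq by (simp add: csinc_def)
    then have "norm (bump s 0 (\<i> * of_real l)) = \<bar>(1 + s * cosh (2 * pi * l)) / 2\<bar>"
      by (simp only: norm_of_real)
    also have "\<dots> = (cosh (2 * pi * l) + s) / 2"
    proof -
      have "s = 1 \<or> s = -1" using s by linarith
      then show ?thesis using cosh_real_ge_1[of "2 * pi * l"] by (auto simp: abs_if field_simps)
    qed
    finally show ?thesis unfolding k .
  qed
  have "gap_kernel s 0 x l = 2 / pi * l\<^sup>2 / ((1 + s * q)\<^sup>2 / (4 * q)) * ((1 + s * cos (2 * pi * x)) / 2 / (x\<^sup>2 + l\<^sup>2))" for x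
  proof -
    have "2 / pi * l\<^sup>2 * (h / 2 * 1\<^sup>2) / (K * X) = 2 / pi * l\<^sup>2 / K * (h / 2 / X)" for h K X :: real
      by simp
    from this[of "1 + s * cos (2 * pi * x)" "(1 + s * q)\<^sup>2 / (4 * q)" "x\<^sup>2 + l\<^sup>2"] show ?thesis
      using l unfolding gap_kernel_def n norm_bump_of_real[OF s] by simp
  qed
  then have "(LINT x|lborel. gap_kernel s 0 x l) = 2 / pi * l\<^sup>2 / ((1 + s * q)\<^sup>2 / (4 * q)) * (pi / l * ((1 + s * q) / 2))"
    by (simp only: integral_mult_right_zero I)
  also have "\<dots> = 4 * l * q / (1 + s * q)"
    using q pos l by (simp add: divide_simps power2_eq_square)
  finally show ?thesis unfolding q_def .
qed

text \<open>Expanding q/(1 - q) into a geometric series and integrating term by term gives pi^-2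
  times the sum of 1/(n + 1)^2, which is pi^2/6.\<close>

lemma has_bochner_integral_Bose:
  "has_bochner_integral lborel
     (\<lambda>l::real. indicator {0<..} l * (4 * l * exp (- (2 * pi * l)) / (1 - exp (- (2 * pi * l))))) (1 / 6)"
proof -
  define f where "f = (\<lambda>n (l::real). 4 * (indicator {0<..} l * (l ^ 1 * exp (- (2 * pi * real (Suc n) * l)))))"
  have f: "has_bochner_integral lborel (f n) (1 / pi\<^sup>2 * (1 / (real n + 1)\<^sup>2))" for n
  proof -
    have e: "1 / pi\<^sup>2 * (1 / (real n + 1)\<^sup>2) = 4 * (fact 1 / (2 * pi * real (Suc n)) ^ Suc 1)"
    proof -
      have "(2 * pi * real (Suc n)) ^ Suc 1 = 4 * pi\<^sup>2 * (real n + 1)\<^sup>2"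
        by (simp add: power2_eq_square algebra_simps)
      then show ?thesis by simp
    qed
    show ?thesis unfolding f_def e
      by (intro has_bochner_integral_mult_right has_bochner_integral_exp_scaled) auto
  qed
  have pt: "(\<lambda>n. f n l) sums (indicator {0<..} l * (4 * l * exp (- (2 * pi * l)) / (1 - exp (- (2 * pi * l)))))" for l
  proof (cases "l > 0")
    case True
    define q where "q = exp (- (2 * pi * l))"
    have q: "norm q < 1" using True by (simp add: q_def)
    have "f n l = 4 * l * q * q ^ n" for n
    proof -
      have "exp (- (2 * pi * real (Suc n) * l)) = q ^ Suc n"
        unfolding q_def exp_of_nat_mult[symmetric] by (rule arg_cong[of _ _ exp]) (simp only: mult_ac mult_minus_right)
      then show ?thesis using True by (simp add: f_def)
    qed
    moreover have "(\<lambda>n. 4 * l * q * q ^ n) sums (4 * l * q * (1 / (1 - q)))"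
      by (intro sums_mult geometric_sums q)
    ultimately show ?thesis using True by (simp add: q_def)
  qed (simp add: f_def)
  have nonneg: "f n l \<ge> 0" for n l
    unfolding f_def by (cases "l > 0") simp_all
  have "(\<lambda>n. 1 / (real n + 1)\<^sup>2) sums (pi\<^sup>2 / 6)"
    using inverse_squares_sums by (simp only: of_nat_add of_nat_1 of_nat_power)
  then have S: "(\<lambda>n. 1 / pi\<^sup>2 * (1 / (real n + 1)\<^sup>2)) sums (1 / pi\<^sup>2 * (pi\<^sup>2 / 6))"
    by (rule sums_mult)
  have int: "integrable lborel (f n)" "(LINT l|lborel. norm (f n l)) = 1 / pi\<^sup>2 * (1 / (real n + 1)\<^sup>2)"
      "integral\<^sup>L lborel (f n) = 1 / pi\<^sup>2 * (1 / (real n + 1)\<^sup>2)" for n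
    using f[of n] nonneg by (auto simp: has_bochner_integral_iff)
  have ae: "AE l in lborel. summable (\<lambda>n. norm (f n l))"
    using pt nonneg by (intro AE_I2) (auto simp: sums_iff)
  have su: "summable (\<lambda>n. LINT l|lborel. norm (f n l))"
    unfolding int using S by (simp add: sums_iff)
  have eq: "(\<lambda>l. suminf (\<lambda>n. f n l)) = (\<lambda>l. indicator {0<..} l * (4 * l * exp (- (2 * pi * l)) / (1 - exp (- (2 * pi * l)))))"
    using pt by (auto simp: sums_iff fun_eq_iff)
  have "integrable lborel (\<lambda>l. suminf (\<lambda>n. f n l))"
    by (rule integrable_suminf[OF int(1) ae su])
  moreover have "(LINT l|lborel. suminf (\<lambda>n. f n l)) = 1 / 6"
    using integral_suminf[OF int(1) ae su] S unfolding int by (simp add: sums_iff)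
  ultimately show ?thesis unfolding eq by (simp add: has_bochner_integral_iff)
qed

text \<open>The identity \<open>q/(1 + q) = q/(1 - q) - 2q\<^sup>2/(1 - q\<^sup>2)\<close> reduces this to the previous integral at \<open>l\<close> and \<open>2l\<close>.\<close>

lemma has_bochner_integral_Fermi:
  "has_bochner_integral lborel
     (\<lambda>l::real. indicator {0<..} l * (4 * l * exp (- (2 * pi * l)) / (1 + exp (- (2 * pi * l))))) (1 / 12)"
proof -
  define g where "g = (\<lambda>l::real. indicator {0<..} l * (4 * l * exp (- (2 * pi * l)) / (1 - exp (- (2 * pi * l)))))"
  have g: "has_bochner_integral lborel g (1 / 6)"
    unfolding g_def by (rule has_bochner_integral_Bose)
  have "has_bochner_integral lborel (\<lambda>l. g (0 + 2 * l)) ((1 / 6) /\<^sub>R \<bar>2\<bar>)"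
    using g lborel_has_bochner_integral_real_affine_iff[of 2 g "1 / 6" 0] by simp
  then have "has_bochner_integral lborel (\<lambda>l. g l - g (0 + 2 * l)) (1 / 6 - (1 / 6) /\<^sub>R \<bar>2\<bar>)"
    by (intro has_bochner_integral_diff g)
  also have "(\<lambda>l. g l - g (0 + 2 * l)) = (\<lambda>l. indicator {0<..} l * (4 * l * exp (- (2 * pi * l)) / (1 + exp (- (2 * pi * l)))))"
  proof
    fix l :: real
    show "g l - g (0 + 2 * l) = indicator {0<..} l * (4 * l * exp (- (2 * pi * l)) / (1 + exp (- (2 * pi * l))))"
    proof (cases "l > 0")
      case True
      define q where "q = exp (- (2 * pi * l))"
      have q: "0 < q" "q < 1" using True by (auto simp: q_def)
      have q2: "exp (- (2 * pi * (2 * l))) = q\<^sup>2"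
        unfolding q_def exp_double[symmetric] by (simp add: mult_ac)
      have "4 * l * q / (1 - q) - 4 * (2 * l) * q\<^sup>2 / (1 - q\<^sup>2) = 4 * l * q / (1 + q)"
      proof -
        have "1 - q\<^sup>2 = (1 - q) * (1 + q)" by (simp add: power2_eq_square algebra_simps)
        then show ?thesis using q by (simp add: divide_simps) (simp add: power2_eq_square algebra_simps)
      qed
      moreover have "g l = 4 * l * q / (1 - q)" "g (0 + 2 * l) = 4 * (2 * l) * q\<^sup>2 / (1 - q\<^sup>2)"
        using True unfolding g_def q2[symmetric] by (simp_all add: q_def)
      ultimately show ?thesis using True by (simp flip: q_def)
    qed (simp add: g_def)
  qed
  finally show ?thesis by simp
qed

text \<open>The integral over the plane is the form suited to dominated convergence in
  \<open>d\<close>; the iterated one, with the inner integral over \<open>x\<close>, is evaluated at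
  \<open>d = 0\<close>.\<close>

lemma integral_gap_eq_pair:
  assumes s: "\<bar>s\<bar> = 1"
  shows "(LINT x|lborel. gap s d x) = (LINT z|(lborel \<Otimes>\<^sub>M lborel). (case z of (x, l) \<Rightarrow> gap_kernel s d x l))"
    and "(LINT x|lborel. gap s d x) = (LINT l|lborel. LINT x|lborel. gap_kernel s d x l)"
proof -
  have i: "integrable (lborel \<Otimes>\<^sub>M lborel) (\<lambda>(x, l). gap_kernel s d x l)"
  proof (rule Bochner_Integration.integrable_bound[OF integrable_kernel_bound])
    show "AE z in lborel \<Otimes>\<^sub>M lborel. norm (case z of (x, l) \<Rightarrow> gap_kernel s d x l)
        \<le> norm (case z of (x, l) \<Rightarrow> kernel_bound x l)"
      using gap_kernel_le(1)[OF s, of d] gap_kernel_nonneg[of s d]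
      by (intro AE_I2) (auto intro: order_trans[OF _ abs_ge_self])
  qed measurable
  show "(LINT x|lborel. gap s d x) = (LINT z|(lborel \<Otimes>\<^sub>M lborel). (case z of (x, l) \<Rightarrow> gap_kernel s d x l))"
    unfolding gap_def by (rule lborel_pair.integral_fst[OF i])
  show "(LINT x|lborel. gap s d x) = (LINT l|lborel. LINT x|lborel. gap_kernel s d x l)"
    unfolding gap_def by (rule lborel_pair.Fubini_integral[OF i, symmetric])
qed

lemma integral_gap_zero:
  assumes "\<bar>s\<bar> = 1"
  shows "(LINT x|lborel. gap s 0 x) = (if s = 1 then 1 / 12 else 1 / 6)"
proof -
  have "(LINT x|lborel. gap s 0 x)
      = (LINT l|lborel. indicator {0<..} l * (4 * l * exp (- (2 * pi * l)) / (1 + s * exp (- (2 * pi * l)))))"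
    unfolding integral_gap_eq_pair(2)[OF assms]
  proof (rule Bochner_Integration.integral_cong[OF refl])
    fix l :: real
    show "(LINT x|lborel. gap_kernel s 0 x l)
        = indicator {0<..} l * (4 * l * exp (- (2 * pi * l)) / (1 + s * exp (- (2 * pi * l))))"
      by (cases "l > 0") (simp_all add: gap_kernel_zero_integral[OF assms], simp add: gap_kernel_def)
  qed
  moreover have "s = 1 \<or> s = -1" using assms by linarith
  ultimately show ?thesis
    using has_bochner_integral_Bose has_bochner_integral_Fermi
    by (auto simp: has_bochner_integral_iff)
qed

text \<open>The integrands converge pointwise because \<open>csinc\<close> is continuous, and
  \<open>kernel_bound\<close> dominates them for every \<open>d\<close>.\<close>

lemma tendsto_integral_gap:
  fixes d :: "real \<Rightarrow> real"
  assumes s: "\<bar>s\<bar> = 1" and d: "(d \<longlongrightarrow> 0) at_top"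
  shows "((\<lambda>r. LINT x|lborel. gap s (d r) x) \<longlongrightarrow> (LINT x|lborel. gap s 0 x)) at_top"
  unfolding integral_gap_eq_pair(1)[OF s]
proof (rule integral_dominated_convergence_at_top[OF _ _ integrable_kernel_bound])
  have bump_tendsto: "((\<lambda>r. bump s (d r) z) \<longlongrightarrow> bump s 0 z) at_top" for z
    unfolding bump_def
    by (intro tendsto_intros continuous_on_tendsto_compose[OF continuous_on_csinc[of UNIV]] d) auto
  show "AE z in lborel \<Otimes>\<^sub>M lborel. ((\<lambda>r. case z of (x, l) \<Rightarrow> gap_kernel s (d r) x l)
      \<longlongrightarrow> (case z of (x, l) \<Rightarrow> gap_kernel s 0 x l)) at_top"
  proof (intro AE_I2)
    fix z :: "real \<times> real"
    obtain x l where z: "z = (x, l)" by force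
    show "((\<lambda>r. case z of (x, l) \<Rightarrow> gap_kernel s (d r) x l) \<longlongrightarrow> (case z of (x, l) \<Rightarrow> gap_kernel s 0 x l)) at_top"
    proof (cases "l > 0")
      case True
      have "norm (bump s 0 (\<i> * of_real l)) > 0"
        using norm_bump_imaginary_pos[OF s] True by simp
      moreover have "x\<^sup>2 + l\<^sup>2 > 0" using True by (intro add_nonneg_pos) auto
      ultimately show ?thesis
        unfolding z gap_kernel_def prod.case by (intro tendsto_intros bump_tendsto) auto
    qed (simp add: z gap_kernel_def)
  qed
  show "\<forall>\<^sub>F r in at_top. AE z in lborel \<Otimes>\<^sub>M lborel. norm (case z of (x, l) \<Rightarrow> gap_kernel s (d r) x l)
      \<le> (case z of (x, l) \<Rightarrow> kernel_bound x l)"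
    using gap_kernel_le(1)[OF s] gap_kernel_nonneg by (intro always_eventually allI AE_I2) auto
qed measurable

section \<open>Fourier transform of the tent\<close>

lemma integrable_mult_character:
  fixes f :: "real \<Rightarrow> complex"
  assumes f: "integrable lborel f"
  shows "integrable lborel (\<lambda>x. f x * exp (- (2 * of_real pi * \<i> * of_real x * of_real t)))"
proof (rule Bochner_Integration.integrable_bound[OF f])
  have [measurable]: "(\<lambda>x. exp (- (2 * of_real pi * \<i> * complex_of_real x * of_real t))) \<in> borel_measurable borel"
    by (intro borel_measurable_continuous_onI continuous_intros)
  show "(\<lambda>x. f x * exp (- (2 * of_real pi * \<i> * complex_of_real x * of_real t))) \<in> borel_measurable lborel"
    using borel_measurable_integrable[OF f] by measurable
qed (simp add: norm_mult)

lemma fourier_transform_add: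
  assumes "integrable lborel f" "integrable lborel g"
  shows "fourier_transform (\<lambda>x. f x + g x) t = fourier_transform f t + fourier_transform g t"
  unfolding fourier_transform_def distrib_right
  by (intro Bochner_Integration.integral_add integrable_mult_character assms)

lemma fourier_transform_cmult:
  "fourier_transform (\<lambda>x. c * f x) t = c * fourier_transform f t"
  unfolding fourier_transform_def mult.assoc integral_mult_right_zero ..

lemma fourier_transform_shift:
  "fourier_transform (\<lambda>x. f (x - a)) t = exp (- (2 * of_real pi * \<i> * of_real a * of_real t)) * fourier_transform f t"
proof -
  have "fourier_transform (\<lambda>x. f (x - a)) t
      = (LINT x|lborel. f x * exp (- (2 * of_real pi * \<i> * of_real (a + x) * of_real t)))"
    unfolding fourier_transform_def
    using lborel_integral_real_affine[of 1 "\<lambda>x. f (x - a) * exp (- (2 * of_real pi * \<i> * of_real x * of_real t))" a]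
    by simp
  also have "\<dots> = (LINT x|lborel. exp (- (2 * of_real pi * \<i> * of_real a * of_real t))
      * (f x * exp (- (2 * of_real pi * \<i> * of_real x * of_real t))))"
  proof -
    have "exp (- (2 * of_real pi * \<i> * of_real (a + x) * of_real t))
        = exp (- (2 * of_real pi * \<i> * of_real a * of_real t)) * exp (- (2 * of_real pi * \<i> * complex_of_real x * of_real t))" for x
      by (simp add: algebra_simps flip: exp_add)
    then show ?thesis by (simp only: mult.left_commute)
  qed
  finally show ?thesis unfolding fourier_transform_def by simp
qed

lemma fourier_transform_scale:
  assumes "r > 0"
  shows "fourier_transform (\<lambda>x. f (r * x)) t = fourier_transform f (t / r) / of_real r"
proof -
  have "fourier_transform f (t / r)
      = r *\<^sub>R (LINT x|lborel. f (r * x) * exp (- (2 * of_real pi * \<i> * of_real (r * x) * of_real (t / r))))"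
    unfolding fourier_transform_def
    using assms lborel_integral_real_affine[of r "\<lambda>x. f x * exp (- (2 * of_real pi * \<i> * of_real x * of_real (t / r)))" 0]
    by simp
  also have "\<dots> = of_real r * fourier_transform (\<lambda>x. f (r * x)) t"
    unfolding fourier_transform_def scaleR_conv_of_real using assms by (simp add: mult_ac)
  finally show ?thesis using assms by simp
qed

text \<open>The point 0 lies in both closed intervals and would be counted twice; it is a null set,
  so the integrals do not see it.\<close>

lemma tent_eq: "tent x = indicator {-1..0} x * (1 + x) + indicator {0..1} x * (1 - x)" if "x \<noteq> 0"
  using that by (auto simp: tent_def indicator_def)

lemma measurable_tent [measurable]: "tent \<in> borel_measurable borel"
  unfolding tent_def by measurable

lemma integrable_tent: "integrable lborel tent"
proof (rule Bochner_Integration.integrable_bound)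
  show "integrable lborel (\<lambda>x::real. indicator {-1..1} x :: real)" by simp
  show "AE x in lborel. norm (tent x) \<le> norm (indicator {-1..1} x :: real)"
    by (intro AE_I2) (auto simp: tent_def indicator_def)
qed measurable

lemma fourier_transform_tent:
  assumes t: "t \<noteq> 0"
  shows "fourier_transform (\<lambda>x. of_real (tent x)) t = of_real ((1 - cos (2 * pi * t)) / (2 * pi\<^sup>2 * t\<^sup>2))"
proof -
  define c where "c = - (2 * of_real pi * \<i> * complex_of_real t)"
  have c: "c \<noteq> 0" using t by (simp add: c_def)
  have c2: "c\<^sup>2 = - of_real (4 * pi\<^sup>2 * t\<^sup>2)" by (simp add: c_def power_mult_distrib)
  define f1 where "f1 = (\<lambda>x. (1 + of_real x) * exp (c * complex_of_real x))"
  define f2 where "f2 = (\<lambda>x. (1 - of_real x) * exp (c * complex_of_real x))"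
  \<comment> \<open>\<open>F1\<close> and \<open>F2\<close> are the antiderivatives of
    \<open>f1\<close> and \<open>f2\<close> found by parts. Their terms 1/c at the common endpoint 0
    cancel, which leaves only terms in 1/c^2.\<close>
  define F1 where "F1 = (\<lambda>x. ((1 + of_real x) / c - 1 / c\<^sup>2) * exp (c * complex_of_real x))"
  define F2 where "F2 = (\<lambda>x. ((1 - of_real x) / c + 1 / c\<^sup>2) * exp (c * complex_of_real x))"
  have d1: "(F1 has_vector_derivative f1 x) (at x within A)" for x A
  proof -
    have "((\<lambda>z. ((1 + z) / c - 1 / c\<^sup>2) * exp (c * z)) has_field_derivative f1 x) (at (of_real x))"
      unfolding f1_def using c
      by (auto intro!: derivative_eq_intros simp: field_simps power2_eq_square)
    from has_vector_derivative_real_field[OF this] show ?thesis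
      unfolding F1_def by (rule has_vector_derivative_at_within)
  qed
  have d2: "(F2 has_vector_derivative f2 x) (at x within A)" for x A
  proof -
    have "((\<lambda>z. ((1 - z) / c + 1 / c\<^sup>2) * exp (c * z)) has_field_derivative f2 x) (at (of_real x))"
      unfolding f2_def using c
      by (auto intro!: derivative_eq_intros simp: field_simps power2_eq_square)
    from has_vector_derivative_real_field[OF this] show ?thesis
      unfolding F2_def by (rule has_vector_derivative_at_within)
  qed
  have cont: "continuous_on A f1" "continuous_on A f2" for A
    unfolding f1_def f2_def by (intro continuous_intros)+
  have [measurable]: "f1 \<in> borel_measurable borel" "f2 \<in> borel_measurable borel"
    by (intro borel_measurable_continuous_onI cont)+
  have int: "integrable lborel (\<lambda>x. indicator {a..b} x *\<^sub>R f1 x)"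
      "integrable lborel (\<lambda>x. indicator {a..b} x *\<^sub>R f2 x)" for a b
    by (intro borel_integrable_compact cont compact_Icc)+
  have "fourier_transform (\<lambda>x. of_real (tent x)) t
      = (LINT x|lborel. indicator {-1..0} x *\<^sub>R f1 x + indicator {0..1} x *\<^sub>R f2 x)"
    unfolding fourier_transform_def
  proof (rule integral_cong_AE)
    show "AE x in lborel. complex_of_real (tent x) * exp (- (2 * of_real pi * \<i> * of_real x * of_real t))
        = indicator {-1..0} x *\<^sub>R f1 x + indicator {0..1} x *\<^sub>R f2 x"
      using AE_lborel_singleton[of 0]
    proof eventually_elim
      case (elim x)
      have e: "exp (- (2 * of_real pi * \<i> * of_real x * of_real t)) = exp (c * complex_of_real x)"
        by (simp add: c_def mult_ac)
      have T: "complex_of_real (tent x) = of_real (indicator {-1..0} x) * (1 + of_real x)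
          + of_real (indicator {0..1} x) * (1 - of_real x)"
        unfolding tent_eq[OF elim] by simp
      show ?case
        unfolding T e f1_def f2_def scaleR_conv_of_real by (simp only: distrib_right mult.assoc)
    qed
    show "(\<lambda>x. complex_of_real (tent x) * exp (- (2 * of_real pi * \<i> * of_real x * of_real t)))
        \<in> borel_measurable lborel"
      by (rule borel_measurable_integrable[OF integrable_mult_character])
         (simp add: integrable_tent)
  qed measurable
  also have "\<dots> = (F1 0 - F1 (-1)) + (F2 1 - F2 0)"
    using integral_FTC_atLeastAtMost[of "-1" 0 F1 f1] integral_FTC_atLeastAtMost[of 0 1 F2 f2]
    by (subst Bochner_Integration.integral_add[OF int]) (simp add: d1 d2 cont)
  also have "\<dots> = (exp c + exp (- c) - 2) / c\<^sup>2"
    using c by (simp add: F1_def F2_def field_simps)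
  also have "exp c + exp (- c) = of_real (2 * cos (2 * pi * t))"
    using cos_exp_eq[of "complex_of_real (2 * pi * t)"] cos_of_real[of "2 * pi * t", where 'a = complex]
    by (simp add: c_def mult_ac)
  also have "(of_real (2 * cos (2 * pi * t)) - 2) / c\<^sup>2 = of_real ((1 - cos (2 * pi * t)) / (2 * pi\<^sup>2 * t\<^sup>2))"
    unfolding c2 using t by (simp add: field_simps)
  finally show ?thesis .
qed

text \<open>After translation the weight is \<bar>a + x\<bar>, which differs from \<bar>a\<bar> by
  at most \<bar>x\<bar>. The mass near \<open>a\<close> is thus weighted by \<bar>a\<bar>, up to the
  first moment of \<open>g\<close>.\<close>

lemma shifted_first_moment:
  fixes g :: "real \<Rightarrow> real"
  assumes g: "integrable lborel g" "integrable lborel (\<lambda>x. \<bar>x\<bar> * g x)" "\<And>x. g x \<ge> 0"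
  shows "integrable lborel (\<lambda>x. \<bar>x\<bar> * g (x - a))"
    and "\<bar>(LINT x|lborel. \<bar>x\<bar> * g (x - a)) - \<bar>a\<bar> * (LINT x|lborel. g x)\<bar> \<le> (LINT x|lborel. \<bar>x\<bar> * g x)"
proof -
  have ineq: "\<bar>\<bar>a + x\<bar> * g x - \<bar>a\<bar> * g x\<bar> \<le> \<bar>x\<bar> * g x" for x
  proof -
    have "\<bar>\<bar>a + x\<bar> - \<bar>a\<bar>\<bar> * g x \<le> \<bar>x\<bar> * g x"
      using g(3) by (intro mult_right_mono) auto
    then show ?thesis using g(3)[of x] by (simp add: abs_mult flip: left_diff_distrib)
  qed
  have [measurable]: "g \<in> borel_measurable borel" using borel_measurable_integrable[OF g(1)] by simp
  have i: "integrable lborel (\<lambda>x. \<bar>a + x\<bar> * g x)"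
  proof (rule Bochner_Integration.integrable_bound)
    show "integrable lborel (\<lambda>x. \<bar>a\<bar> * g x + \<bar>x\<bar> * g x)" using g by simp
    have "\<bar>a + x\<bar> * g x \<le> \<bar>a\<bar> * g x + \<bar>x\<bar> * g x" for x
      using g(3)[of x] by (simp add: mult_right_mono flip: distrib_right)
    then show "AE x in lborel. norm (\<bar>a + x\<bar> * g x) \<le> norm (\<bar>a\<bar> * g x + \<bar>x\<bar> * g x)"
      using g(3) by (intro AE_I2) simp
  qed measurable
  show "integrable lborel (\<lambda>x. \<bar>x\<bar> * g (x - a))"
    using i lborel_integrable_real_affine_iff[of 1 "\<lambda>x. \<bar>x\<bar> * g (x - a)" a] by simp
  have "(LINT x|lborel. \<bar>x\<bar> * g (x - a)) = (LINT x|lborel. \<bar>a + x\<bar> * g x)"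
    using lborel_integral_real_affine[of 1 "\<lambda>x. \<bar>x\<bar> * g (x - a)" a] by simp
  then have "(LINT x|lborel. \<bar>x\<bar> * g (x - a)) - \<bar>a\<bar> * (LINT x|lborel. g x)
      = (LINT x|lborel. \<bar>a + x\<bar> * g x - \<bar>a\<bar> * g x)"
    using i g(1) by simp
  also have "\<bar>\<dots>\<bar> \<le> (LINT x|lborel. \<bar>\<bar>a + x\<bar> * g x - \<bar>a\<bar> * g x\<bar>)"
    using integral_norm_bound[of lborel "\<lambda>x. \<bar>a + x\<bar> * g x - \<bar>a\<bar> * g x"] by simp
  also have "\<dots> \<le> (LINT x|lborel. \<bar>x\<bar> * g x)"
    using i g(1,2) ineq by (intro integral_mono) auto
  finally show "\<bar>(LINT x|lborel. \<bar>x\<bar> * g (x - a)) - \<bar>a\<bar> * (LINT x|lborel. g x)\<bar> \<le> (LINT x|lborel. \<bar>x\<bar> * g x)" .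
qed

section \<open>Assembling the kinks\<close>

text \<open>The error for \<bar>x\<bar>/2 = \<bar>r x\<bar>/(2r) at bandwidth r (1 + d). The half
  fits the decomposition of the tent as \<bar>x - 1\<bar>/2 + \<bar>x + 1\<bar>/2 -
  \<bar>x\<bar>.\<close>

definition kink_gap :: "real \<Rightarrow> real \<Rightarrow> real \<Rightarrow> real \<Rightarrow> real" where
  "kink_gap s d r x = gap s d (r * x) / (2 * r)"

lemma kink_gap_nonneg: "r > 0 \<Longrightarrow> 0 \<le> kink_gap s d r x"
  by (simp add: kink_gap_def gap_nonneg)

lemma kink_gap_integral:
  assumes "\<bar>s\<bar> = 1" "r > 0"
  shows "has_bochner_integral lborel (kink_gap s d r) ((LINT x|lborel. gap s d x) / (2 * r\<^sup>2))"
proof -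
  have "has_bochner_integral lborel (gap s d) (LINT x|lborel. gap s d x)"
    using integrable_gap[OF assms(1)] by (simp add: has_bochner_integral_iff)
  then have "has_bochner_integral lborel (\<lambda>x. gap s d (0 + r * x)) ((LINT x|lborel. gap s d x) /\<^sub>R \<bar>r\<bar>)"
    using lborel_has_bochner_integral_real_affine_iff[of r "gap s d" _ 0] assms by simp
  from has_bochner_integral_mult_right[OF this, of "1 / (2 * r)"] show ?thesis
    unfolding kink_gap_def
    by (rule has_bochner_integral_cong[THEN iffD1, rotated 3])
       (use assms in \<open>auto simp: field_simps power2_eq_square\<close>)
qed

lemma kink_gap_moment:
  assumes "\<bar>s\<bar> = 1" "d > 0" "r > 0"
  shows "integrable lborel (\<lambda>x. \<bar>x\<bar> * kink_gap s d r x)"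
    and "(LINT x|lborel. \<bar>x\<bar> * kink_gap s d r x) \<le> 17 / (2 * d * r ^ 3)"
proof -
  define m where "m = (LINT x|lborel. \<bar>x\<bar> * gap s d x)"
  have "has_bochner_integral lborel (\<lambda>x. \<bar>x\<bar> * gap s d x) m"
    using gap_moment(1)[OF assms(1,2)] by (simp add: has_bochner_integral_iff m_def)
  then have "has_bochner_integral lborel (\<lambda>x. \<bar>0 + r * x\<bar> * gap s d (0 + r * x)) (m /\<^sub>R \<bar>r\<bar>)"
    using lborel_has_bochner_integral_real_affine_iff[of r "\<lambda>x. \<bar>x\<bar> * gap s d x" _ 0] assms by simp
  from has_bochner_integral_mult_right[OF this, of "1 / (2 * r\<^sup>2)"]
  have "has_bochner_integral lborel (\<lambda>x. \<bar>x\<bar> * kink_gap s d r x) (m / (2 * r ^ 3))"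
    unfolding kink_gap_def
    by (rule has_bochner_integral_cong[THEN iffD1, rotated 3])
       (use assms in \<open>auto simp: abs_mult field_simps power2_eq_square power3_eq_cube\<close>)
  moreover have "m / (2 * r ^ 3) \<le> 17 / d / (2 * r ^ 3)"
    using gap_moment(2)[OF assms(1,2)] assms unfolding m_def by (intro divide_right_mono) auto
  ultimately show "integrable lborel (\<lambda>x. \<bar>x\<bar> * kink_gap s d r x)"
    and "(LINT x|lborel. \<bar>x\<bar> * kink_gap s d r x) \<le> 17 / (2 * d * r ^ 3)"
    by (simp_all add: has_bochner_integral_iff mult_ac)
qed

text \<open>Scaling moves the threshold to r (1 + d) but leaves the value unchanged, since
  \<bar>x\<bar> is homogeneous and all powers of \<open>r\<close> cancel.\<close>

lemma kink_gap_fourier: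
  assumes s: "\<bar>s\<bar> = 1" and d: "d \<ge> 0" and r: "r > 0" and t: "r * (1 + d) \<le> \<bar>t\<bar>"
  shows "fourier_transform (\<lambda>x. of_real (kink_gap s d r x)) t = of_real (s / (4 * pi\<^sup>2 * t\<^sup>2))"
proof -
  have t0: "t \<noteq> 0" using t r d by (auto simp: mult_le_0_iff)
  have "1 + d \<le> \<bar>t / r\<bar>" using t r by (simp add: field_simps)
  from gap_fourier[OF s d this]
  have *: "fourier_transform (\<lambda>x. of_real (gap s d x)) (t / r) = of_real (s / (2 * pi\<^sup>2 * (t / r)\<^sup>2))"
    unfolding fourier_transform_def .
  have "fourier_transform (\<lambda>x. of_real (kink_gap s d r x)) t
      = fourier_transform (\<lambda>x. of_real (1 / (2 * r)) * complex_of_real (gap s d (r * x))) t"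
    by (simp add: kink_gap_def)
  also have "\<dots> = of_real (1 / (2 * r)) * (of_real (s / (2 * pi\<^sup>2 * (t / r)\<^sup>2)) / of_real r)"
    unfolding fourier_transform_cmult fourier_transform_scale[OF r, of "\<lambda>x. of_real (gap s d x)"] * ..
  also have "\<dots> = of_real (1 / (2 * r) * (s / (2 * pi\<^sup>2 * (t / r)\<^sup>2) / r))"
    by (simp only: of_real_mult of_real_divide)
  also have "1 / (2 * r) * (s / (2 * pi\<^sup>2 * (t / r)\<^sup>2) / r) = s / (4 * pi\<^sup>2 * t\<^sup>2)"
    using r t0 by (simp add: power_divide field_simps power2_eq_square)
  finally show ?thesis .
qed

text \<open>The tent has convex kinks at \<open>\<plusminus>1\<close> and a concave one, of twice the size, at \<open>0\<close>.\<close>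

definition tent_gap :: "real \<Rightarrow> real \<Rightarrow> real \<Rightarrow> real \<Rightarrow> real" where
  "tent_gap s d r x = kink_gap s d r (x - 1) + kink_gap s d r (x + 1) + 2 * kink_gap (- s) d r x"

lemma tent_gap_nonneg: "r > 0 \<Longrightarrow> 0 \<le> tent_gap s d r x"
  by (simp add: tent_gap_def kink_gap_nonneg)

text \<open>Beyond the threshold the transforms of the three kinks are k exp(-2 pi i t), k exp(2 pi
  i t) and -2k, the concave kink at 0 having the opposite sign. Their sum k (2 cos(2 pi t) - 2),
  multiplied by \<open>s\<close>, cancels the transform of the tent because s^2 = 1.\<close>

lemma tent_gap_band_limited:
  assumes s: "\<bar>s\<bar> = 1" and d: "d \<ge> 0" and r: "r > 0"
  shows "band_limited (r * (1 + d)) (\<lambda>x. tent x + s * tent_gap s d r x)"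
proof -
  have s': "\<bar>- s\<bar> = 1" using s by simp
  have i: "integrable lborel (kink_gap s d r)" "integrable lborel (kink_gap (- s) d r)"
    using kink_gap_integral[OF s r] kink_gap_integral[OF s' r] by (auto simp: has_bochner_integral_iff)
  have i1: "integrable lborel (\<lambda>x. kink_gap s d r (x - 1))" "integrable lborel (\<lambda>x. kink_gap s d r (x + 1))"
    using i(1) lborel_integrable_real_affine_iff[of 1 "kink_gap s d r" "-1"]
      lborel_integrable_real_affine_iff[of 1 "kink_gap s d r" 1] by (simp_all add: add.commute)
  have ft: "fourier_transform (\<lambda>x. of_real (tent x + s * tent_gap s d r x)) t = 0" if t: "r * (1 + d) < \<bar>t\<bar>" for t
  proof -
    have t0: "t \<noteq> 0" using t r d by (auto simp: mult_less_0_iff)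
    define k where "k = complex_of_real (s / (4 * pi\<^sup>2 * t\<^sup>2))"
    have F: "fourier_transform (\<lambda>x. of_real (kink_gap s d r x)) t = k"
      "fourier_transform (\<lambda>x. of_real (kink_gap (- s) d r x)) t = - k"
      unfolding k_def using kink_gap_fourier[OF s d r, of t] kink_gap_fourier[OF s' d r, of t] t by auto
    have F1: "fourier_transform (\<lambda>x. of_real (kink_gap s d r (x - 1))) t = exp (- (2 * of_real pi * \<i> * of_real t)) * k"
      using fourier_transform_shift[of "\<lambda>x. of_real (kink_gap s d r x)" 1 t] F by simp
    have F2: "fourier_transform (\<lambda>x. of_real (kink_gap s d r (x + 1))) t = exp (2 * of_real pi * \<i> * of_real t) * k"
      using fourier_transform_shift[of "\<lambda>x. of_real (kink_gap s d r x)" "-1" t] F by simp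
    have e: "exp (- (2 * of_real pi * \<i> * of_real t)) + exp (2 * of_real pi * \<i> * of_real t) = complex_of_real (2 * cos (2 * pi * t))"
      using cos_exp_eq[of "complex_of_real (2 * pi * t)"] cos_of_real[of "2 * pi * t", where 'a = complex]
      by (simp add: mult_ac)
    have eq: "(\<lambda>x. complex_of_real (tent x + s * tent_gap s d r x))
      = (\<lambda>x. of_real (tent x) + of_real s * ((of_real (kink_gap s d r (x - 1)) + of_real (kink_gap s d r (x + 1)))
            + 2 * of_real (kink_gap (- s) d r x)))"
      by (simp add: tent_gap_def fun_eq_iff)
    have "fourier_transform (\<lambda>x. of_real (tent x + s * tent_gap s d r x)) t
        = of_real ((1 - cos (2 * pi * t)) / (2 * pi\<^sup>2 * t\<^sup>2))
          + of_real s * (exp (- (2 * of_real pi * \<i> * of_real t)) * k + exp (2 * of_real pi * \<i> * of_real t) * k + 2 * (- k))"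
      unfolding eq using i i1 integrable_tent
      by (simp add: fourier_transform_add fourier_transform_cmult F F1 F2 fourier_transform_tent t0)
    also have "\<dots> = of_real ((1 - cos (2 * pi * t)) / (2 * pi\<^sup>2 * t\<^sup>2)) + of_real s * ((of_real (2 * cos (2 * pi * t)) - 2) * k)"
      unfolding e[symmetric] by (simp add: algebra_simps)
    also have "\<dots> = of_real ((1 - cos (2 * pi * t)) / (2 * pi\<^sup>2 * t\<^sup>2) + (s * s) * ((2 * cos (2 * pi * t) - 2) / (4 * pi\<^sup>2 * t\<^sup>2)))"
      by (simp add: k_def)
    also have "s * s = 1" using s by (metis abs_mult_self_eq mult_1)
    also have "(1 - cos (2 * pi * t)) / (2 * pi\<^sup>2 * t\<^sup>2) + 1 * ((2 * cos (2 * pi * t) - 2) / (4 * pi\<^sup>2 * t\<^sup>2)) = 0"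
      using t0 by (simp add: field_simps)
    finally show ?thesis by simp
  qed
  have "integrable lborel (\<lambda>x. tent x + s * tent_gap s d r x)"
    unfolding tent_gap_def using i i1 integrable_tent by simp
  moreover have "support (fourier_transform (\<lambda>x. of_real (tent x + s * tent_gap s d r x))) \<subseteq> {- (r * (1 + d))..r * (1 + d)}"
    unfolding support_def
  \<comment> \<open>The interval is closed, so vanishing strictly outside it is enough for the
    closure in \<open>support\<close>.\<close>
  proof (rule closure_minimal)
    show "{t. fourier_transform (\<lambda>x. of_real (tent x + s * tent_gap s d r x)) t \<noteq> 0} \<subseteq> {- (r * (1 + d))..r * (1 + d)}"
      using ft by (force simp: abs_less_iff not_less abs_if split: if_splits)
  qed simp
  ultimately show ?thesis unfolding band_limited_def by blast
qed

text \<open>Each of the kinks at 1 and -1 has weight 1 and contributes half of the main term. The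
  error consists of four first moments of size at most 17/(2 d r^3): one for each shift and two for
  the kink at 0.\<close>

lemma tent_gap_moment:
  assumes s: "\<bar>s\<bar> = 1" and d: "d > 0" and r: "r > 0"
  shows "integrable lborel (\<lambda>x. \<bar>x\<bar> * tent_gap s d r x)"
    and "\<bar>(LINT x|lborel. \<bar>x\<bar> * tent_gap s d r x) - (LINT x|lborel. gap s d x) / r\<^sup>2\<bar> \<le> 34 / (d * r ^ 3)"
proof -
  have s': "\<bar>- s\<bar> = 1" using s by simp
  have k: "integrable lborel (kink_gap s d r)" "(LINT x|lborel. kink_gap s d r x) = (LINT x|lborel. gap s d x) / (2 * r\<^sup>2)"
    using kink_gap_integral[OF s r, of d] by (auto simp: has_bochner_integral_iff)
  note m = kink_gap_moment[OF s d r] and m' = kink_gap_moment[OF s' d r]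
  note sh = shifted_first_moment[OF k(1) m(1) kink_gap_nonneg[OF r]]
  have i: "integrable lborel (\<lambda>x. \<bar>x\<bar> * kink_gap s d r (x - 1))" "integrable lborel (\<lambda>x. \<bar>x\<bar> * kink_gap s d r (x + 1))"
      "integrable lborel (\<lambda>x. 2 * (\<bar>x\<bar> * kink_gap (- s) d r x))"
    using sh(1)[of 1] sh(1)[of "-1"] m'(1) by auto
  have eq: "(\<lambda>x. \<bar>x\<bar> * tent_gap s d r x) = (\<lambda>x. (\<bar>x\<bar> * kink_gap s d r (x - 1) + \<bar>x\<bar> * kink_gap s d r (x + 1))
      + 2 * (\<bar>x\<bar> * kink_gap (- s) d r x))"
    by (simp add: tent_gap_def fun_eq_iff algebra_simps)
  show "integrable lborel (\<lambda>x. \<bar>x\<bar> * tent_gap s d r x)"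
    unfolding eq by (intro Bochner_Integration.integrable_add i)
  have I: "(LINT x|lborel. \<bar>x\<bar> * tent_gap s d r x) = (LINT x|lborel. \<bar>x\<bar> * kink_gap s d r (x - 1))
      + (LINT x|lborel. \<bar>x\<bar> * kink_gap s d r (x + 1)) + 2 * (LINT x|lborel. \<bar>x\<bar> * kink_gap (- s) d r x)"
    unfolding eq using i by simp
  have "0 \<le> (LINT x|lborel. \<bar>x\<bar> * kink_gap (- s) d r x)"
    using kink_gap_nonneg[OF r] by (intro Bochner_Integration.integral_nonneg) auto
  moreover have "34 / (d * r ^ 3) = 4 * (17 / (2 * d * r ^ 3))" by simp
  moreover have "(LINT x|lborel. gap s d x) / r\<^sup>2 = 2 * ((LINT x|lborel. gap s d x) / (2 * r\<^sup>2))" by simp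
  ultimately show "\<bar>(LINT x|lborel. \<bar>x\<bar> * tent_gap s d r x) - (LINT x|lborel. gap s d x) / r\<^sup>2\<bar> \<le> 34 / (d * r ^ 3)"
    using sh(2)[of 1] sh(2)[of "-1"] m(2) m'(2) unfolding I k(2) by simp
qed

text \<open>The choice r = D/(1 + d) makes the bandwidth r (1 + d) exactly D. The error 34/(d r^3),
  multiplied by D^2, becomes 34 (1 + d)^3/(d D), which tends to 0 since d D = sqrt D.\<close>

lemma tent_gap_asymptotics:
  fixes s :: real
  defines "d \<equiv> \<lambda>D. 1 / sqrt D"
  assumes s: "\<bar>s\<bar> = 1"
  shows "((\<lambda>D. D\<^sup>2 * (LINT x|lborel. \<bar>x\<bar> * tent_gap s (d D) (D / (1 + d D)) x))
           \<longlongrightarrow> (if s = 1 then 1 / 12 else 1 / 6)) at_top"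
proof -
  define W where "W = (\<lambda>D. LINT x|lborel. \<bar>x\<bar> * tent_gap s (d D) (D / (1 + d D)) x)"
  define I where "I = (\<lambda>D. LINT x|lborel. gap s (d D) x)"
  have d0: "(d \<longlongrightarrow> 0) at_top" unfolding d_def by real_asymp
  have I: "(I \<longlongrightarrow> (if s = 1 then 1 / 12 else 1 / 6)) at_top"
    unfolding I_def using tendsto_integral_gap[OF s d0] integral_gap_zero[OF s] by simp
  have "((\<lambda>D. D\<^sup>2 * W D - I D * (1 + d D)\<^sup>2) \<longlongrightarrow> 0) at_top"
  proof (rule Lim_null_comparison)
    show "\<forall>\<^sub>F D in at_top. norm (D\<^sup>2 * W D - I D * (1 + d D)\<^sup>2) \<le> 34 * (1 + d D) ^ 3 / (d D * D)"
      using eventually_gt_at_top[of 0]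
    proof eventually_elim
      case (elim D)
      define r where "r = D / (1 + d D)"
      have dp: "d D > 0" using elim by (simp add: d_def)
      have r: "r > 0" using elim dp by (simp add: r_def)
      have Dr: "D = r * (1 + d D)" using dp by (simp add: r_def)
      have "D\<^sup>2 * W D - I D * (1 + d D)\<^sup>2 = D\<^sup>2 * (W D - I D / r\<^sup>2)"
        using r dp elim by (simp add: r_def power_divide right_diff_distrib)
      then have "norm (D\<^sup>2 * W D - I D * (1 + d D)\<^sup>2) = D\<^sup>2 * \<bar>W D - I D / r\<^sup>2\<bar>"
        by (simp add: abs_mult)
      also have "\<dots> \<le> D\<^sup>2 * (34 / (d D * r ^ 3))"
        using tent_gap_moment(2)[OF s dp r] unfolding W_def I_def r_def by (intro mult_left_mono) auto
      also have "\<dots> = 34 * (1 + d D) ^ 3 / (d D * D)"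
        using elim dp by (simp add: r_def power_divide field_simps power2_eq_square power3_eq_cube)
      finally show ?case .
    qed
    show "((\<lambda>D. 34 * (1 + d D) ^ 3 / (d D * D)) \<longlongrightarrow> 0) at_top"
      unfolding d_def by real_asymp
  qed
  moreover have "((\<lambda>D. I D * (1 + d D)\<^sup>2) \<longlongrightarrow> (if s = 1 then 1 / 12 else 1 / 6) * (1 + 0)\<^sup>2) at_top"
    by (intro tendsto_intros I d0)
  ultimately have "((\<lambda>D. (D\<^sup>2 * W D - I D * (1 + d D)\<^sup>2) + I D * (1 + d D)\<^sup>2)
      \<longlongrightarrow> 0 + (if s = 1 then 1 / 12 else 1 / 6) * (1 + 0)\<^sup>2) at_top"
    by (rule tendsto_add)
  then show ?thesis unfolding W_def by simp
qed

theorem proposition1p3: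
  "\<exists>(fm :: real \<Rightarrow> real \<Rightarrow> real) (fp :: real \<Rightarrow> real \<Rightarrow> real)
     (em :: real \<Rightarrow> real) (ep :: real \<Rightarrow> real).
     em \<in> o[at_top](\<lambda>_. 1) \<and> ep \<in> o[at_top](\<lambda>_. 1) \<and>
     (\<forall>\<^sub>F \<Delta> in at_top.
        band_limited \<Delta> (fm \<Delta>) \<and> band_limited \<Delta> (fp \<Delta>) \<and>
        (\<forall>x. fm \<Delta> x \<le> tent x \<and> tent x \<le> fp \<Delta> x) \<and>
        integrable lborel (\<lambda>x. \<bar>x\<bar> * (tent x - fm \<Delta> x)) \<and>
        integrable lborel (\<lambda>x. \<bar>x\<bar> * (fp \<Delta> x - tent x)) \<and>
        (LINT x|lborel. \<bar>x\<bar> * (tent x - fm \<Delta> x)) = (1 + em \<Delta>) / (6 * \<Delta>\<^sup>2) \<and>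
        (LINT x|lborel. \<bar>x\<bar> * (fp \<Delta> x - tent x)) = (1 + ep \<Delta>) / (12 * \<Delta>\<^sup>2))"
proof -
  define d :: "real \<Rightarrow> real" where "d = (\<lambda>D. 1 / sqrt D)"
  define r :: "real \<Rightarrow> real" where "r = (\<lambda>D. D / (1 + d D))"
  define W where "W = (\<lambda>s D. LINT x|lborel. \<bar>x\<bar> * tent_gap s (d D) (r D) x)"
  \<comment> \<open>The factors -1 and 1 are kept so that both functions have the form tent + s *
    gap of \<open>tent_gap_band_limited\<close>; nonnegativity of the gap then gives a minorant and
    a majorant.\<close>
  define fm where "fm = (\<lambda>D x. tent x + (- 1) * tent_gap (- 1) (d D) (r D) x)"
  define fp where "fp = (\<lambda>D x. tent x + 1 * tent_gap 1 (d D) (r D) x)"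
  \<comment> \<open>\<open>em\<close> and \<open>ep\<close> are solved from the required identities,
    which then hold for D > 0 by construction; only their limits need an argument.\<close>
  define em where "em = (\<lambda>D. 6 * (D\<^sup>2 * W (- 1) D) - 1)"
  define ep where "ep = (\<lambda>D. 12 * (D\<^sup>2 * W 1 D) - 1)"
  have Wm: "((\<lambda>D. D\<^sup>2 * W (- 1) D) \<longlongrightarrow> 1 / 6) at_top"
    using tent_gap_asymptotics[of "- 1"] by (simp add: W_def d_def r_def)
  have Wp: "((\<lambda>D. D\<^sup>2 * W 1 D) \<longlongrightarrow> 1 / 12) at_top"
    using tent_gap_asymptotics[of 1] by (simp add: W_def d_def r_def)
  have "(em \<longlongrightarrow> 6 * (1 / 6) - 1) at_top" "(ep \<longlongrightarrow> 12 * (1 / 12) - 1) at_top"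
    unfolding em_def ep_def by (intro tendsto_intros Wm Wp)+
  then have "em \<in> o[at_top](\<lambda>_. 1)" "ep \<in> o[at_top](\<lambda>_. 1)"
    by (auto intro!: smalloI_tendsto)
  moreover have "\<forall>\<^sub>F \<Delta> in at_top.
        band_limited \<Delta> (fm \<Delta>) \<and> band_limited \<Delta> (fp \<Delta>) \<and>
        (\<forall>x. fm \<Delta> x \<le> tent x \<and> tent x \<le> fp \<Delta> x) \<and>
        integrable lborel (\<lambda>x. \<bar>x\<bar> * (tent x - fm \<Delta> x)) \<and>
        integrable lborel (\<lambda>x. \<bar>x\<bar> * (fp \<Delta> x - tent x)) \<and>
        (LINT x|lborel. \<bar>x\<bar> * (tent x - fm \<Delta> x)) = (1 + em \<Delta>) / (6 * \<Delta>\<^sup>2) \<and>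
        (LINT x|lborel. \<bar>x\<bar> * (fp \<Delta> x - tent x)) = (1 + ep \<Delta>) / (12 * \<Delta>\<^sup>2)"
    using eventually_gt_at_top[of 0]
  proof eventually_elim
    case (elim D)
    have d: "d D > 0" using elim by (simp add: d_def)
    have r: "r D > 0" and rD: "r D * (1 + d D) = D" using elim d by (simp_all add: r_def)
    have "band_limited D (fm D)" "band_limited D (fp D)"
      unfolding fm_def fp_def
      using tent_gap_band_limited[of "- 1" "d D" "r D"] tent_gap_band_limited[of 1 "d D" "r D"] d r
      unfolding rD by simp_all
    moreover have "fm D x \<le> tent x \<and> tent x \<le> fp D x" for x
      by (simp add: fm_def fp_def tent_gap_nonneg[OF r])
    moreover have "(\<lambda>x. \<bar>x\<bar> * (tent x - fm D x)) = (\<lambda>x. \<bar>x\<bar> * tent_gap (- 1) (d D) (r D) x)"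
      "(\<lambda>x. \<bar>x\<bar> * (fp D x - tent x)) = (\<lambda>x. \<bar>x\<bar> * tent_gap 1 (d D) (r D) x)"
      by (simp_all add: fm_def fp_def)
    moreover have "integrable lborel (\<lambda>x. \<bar>x\<bar> * tent_gap (- 1) (d D) (r D) x)"
      "integrable lborel (\<lambda>x. \<bar>x\<bar> * tent_gap 1 (d D) (r D) x)"
      using d r by (auto intro: tent_gap_moment)
    moreover have "W (- 1) D = (1 + em D) / (6 * D\<^sup>2)" "W 1 D = (1 + ep D) / (12 * D\<^sup>2)"
      using elim by (simp_all add: em_def ep_def)
    ultimately show ?case by (simp add: W_def)
  qed
  ultimately show ?thesis by blast
qed

end
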